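(* Let $B$ be a nonzero $m\times n$ integer matrix and let $\mathbf B:\mathbb Z^m\times\mathbb Z^n\to\mathbb Z$ be given by $\mathbf B(\mathbf u,\mathbf v)=\mathbf u^TB\mathbf v$. Then the solvability in the integers of systems of equations of the form $$\sum_{i,j=1}^r a_{ij}^{(q)}\mathbf B(\mathbf u_i,\mathbf v_j)=c_q,\qquad q=1,\ldots,s,$$ for unknowns $\mathbf u_i=(u_{i1},\ldots,u_{im})\in\mathbb Z^m$ and $\mathbf v_j=(v_{j1},\ldots,v_{jn})\in\mathbb Z^n$, $1\le i,j\le r$, is undecidable.
   Context: The matrix $B$ is fixed; an instance of the decision problem consists of positive integers $r,s$ and integers $a_{ij}^{(q)}$ and $c_q$ for $1\le i,j\le r$, $1\le q\le s$. Undecidable means that there is no algorithm which, given an instance, decides whether it has a solution. *)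

theory Defs
  imports "Jordan_Normal_Form.Matrix" "HOL-Library.Nat_Bijection"
begin

text \<open>
  Algorithms are partial recursive functions (Kleene).  Programs carry no arity; a program that is
  applied to an argument list of unsuitable length is undefined (or ignores the surplus arguments).
\<close>

datatype recf =
    Zero
  | Succ
  | Proj nat
  | Comp recf "recf list"
  | PrimRec recf recf
  | Mu recf

text \<open>
  The value \<open>None\<close> means divergence.  Composition is strict.  The recursion variable of
  \<open>PrimRec\<close> and the search variable of \<open>Mu\<close> are the first argument, and the search diverges as soon
  as it meets an undefined value before the first zero.
\<close>

fun rec_eval :: "recf \<Rightarrow> nat list \<Rightarrow> nat option" where
  "rec_eval Zero xs = Some 0"
| "rec_eval Succ xs = (case xs of [] \<Rightarrow> None | x # _ \<Rightarrow> Some (Suc x))"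
| "rec_eval (Proj i) xs = (if i < length xs then Some (xs ! i) else None)"
| "rec_eval (Comp f gs) xs =
    (let ys = map (\<lambda>g. rec_eval g xs) gs
     in if None \<in> set ys then None else rec_eval f (map the ys))"
| "rec_eval (PrimRec f g) xs =
    (case xs of
       [] \<Rightarrow> None
     | k # zs \<Rightarrow>
         rec_nat (rec_eval f zs) (\<lambda>l y. Option.bind y (\<lambda>v. rec_eval g (l # v # zs))) k)"
| "rec_eval (Mu f) xs =
    (if \<exists>k. rec_eval f (k # xs) = Some 0 \<and> (\<forall>l<k. rec_eval f (l # xs) \<noteq> None)
     then Some (LEAST k. rec_eval f (k # xs) = Some 0)
     else None)"

text \<open>
  An instance is given by \<open>r\<close>, \<open>s\<close>, the coefficients \<open>a q i j\<close> and the right-hand sides \<open>c q\<close>, where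
  indices start at 0, so that only the values for \<open>q < s\<close> and \<open>i, j < r\<close> matter.
\<close>

definition system_solvable ::
  "nat \<Rightarrow> nat \<Rightarrow> int mat \<Rightarrow> nat \<Rightarrow> nat \<Rightarrow> (nat \<Rightarrow> nat \<Rightarrow> nat \<Rightarrow> int) \<Rightarrow> (nat \<Rightarrow> int) \<Rightarrow> bool"
where
  "system_solvable m n B r s a c \<longleftrightarrow>
    (\<exists>u v. (\<forall>i<r. u i \<in> carrier_vec m) \<and> (\<forall>j<r. v j \<in> carrier_vec n) \<and>
      (\<forall>q<s. (\<Sum>i<r. \<Sum>j<r. a q i j * (u i \<bullet> (B *\<^sub>v v j))) = c q))"

definition instance_code ::
  "nat \<Rightarrow> nat \<Rightarrow> (nat \<Rightarrow> nat \<Rightarrow> nat \<Rightarrow> int) \<Rightarrow> (nat \<Rightarrow> int) \<Rightarrow> nat"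
where
  "instance_code r s a c = list_encode
    [r, s,
     list_encode (map (\<lambda>q. list_encode (map (\<lambda>i. list_encode (map (\<lambda>j. int_encode (a q i j))
       [0..<r])) [0..<r])) [0..<s]),
     list_encode (map (\<lambda>q. int_encode (c q)) [0..<s])]"

text \<open>
  The code determines the instance, so no information is withheld from the algorithm.
\<close>

lemma instance_code_eq_iff:
  "instance_code r s a c = instance_code r' s' a' c' \<longleftrightarrow>
    r = r' \<and> s = s' \<and> (\<forall>q<s. \<forall>i<r. \<forall>j<r. a q i j = a' q i j) \<and> (\<forall>q<s. c q = c' q)"
  by (auto simp: instance_code_def list_encode_eq int_encode_eq)

end

(* Fix a supposed decision procedure f. Let h be a partial recursive function of four numbers that
   assembles from them the code of an instance, in which these four numbers also occur as right-hand
   sides, and that converges iff f rejects the instance. By the theorem of Davis, Putnam, Robinson and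
   Matiyasevich the domain of h is Diophantine, and systems of polynomial equations over the natural
   numbers can be written as bilinear systems for B. This gives an instance, with the arguments of h
   as right-hand sides, that is solvable iff h converges; feeding h with the numbers that describe
   this very instance is contradictory.

   To write products by means of B, take vectors u_i and v_i (i < k), with k maximal, on which B is
   diagonal with nonzero entries and whose first entry d is the least positive value of B, hence a
   divisor of all values. Prescribing these Gram entries and orthogonality to all vectors but the
   first ones forces d B(x, y) = B(x, v_0) B(u_0, y), so that B multiplies the integers
   B(x, v_0) / d and B(u_0, y) / d. Nonnegativity is expressed by sums of four squares.

   For the Diophantine representation, powers are obtained from Pell equations, then binomial
   coefficients as digits and factorials as quotients of these; bounded quantifiers are
   eliminated by the Chinese remainder theorem, and partial recursive functions are treated by
   induction on programs. *)

theory Submission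
  imports Defs "HOL-Number_Theory.Number_Theory"
begin

section \<open>Pell equations\<close>

text \<open>No equation can name a fixed vector, so the diagonal vectors are unknowns too: every
  solution brings its own, and only their Gram entries are prescribed. Hence maximality of k is
  needed for all diagonal systems with these entries at once. Values of a form of higher rank do not
  factor as products; orthogonality to all pairs but the first cuts the form down to rank one on the
  remaining vectors. As d divides all values, the quotients by d are integers, and multiples of the
  first pair realise every integer.

  The diagonal argument uses neither a universal function nor a numbering of programs. The arguments
  of h enter the instance through right-hand sides only, so the number of unknowns, the number of
  equations and the coefficients are settled before these arguments are chosen. The fourth argument
  codes just the remaining right-hand sides, so that describing the instance to itself is not
  circular.\<close>

fun pell_x :: "int \<Rightarrow> nat \<Rightarrow> int" and pell_y :: "int \<Rightarrow> nat \<Rightarrow> int" where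
  "pell_x a 0 = 1"
| "pell_x a (Suc n) = a * pell_x a n + (a\<^sup>2 - 1) * pell_y a n"
| "pell_y a 0 = 0"
| "pell_y a (Suc n) = pell_x a n + a * pell_y a n"

text \<open>The number \<open>pell_x a n + pell_y a n * sqrt (a\<^sup>2 - 1)\<close> is the
  \<open>n\<close>-th power of the unit \<open>a + sqrt (a\<^sup>2 - 1)\<close>, whose norm is
  1.\<close>

lemma pell_eq: "(pell_x a n)\<^sup>2 = (a\<^sup>2 - 1) * (pell_y a n)\<^sup>2 + 1"
proof (induction n)
  case (Suc n)
  have "(pell_x a (Suc n))\<^sup>2 - (a\<^sup>2 - 1) * (pell_y a (Suc n))\<^sup>2
      = (pell_x a n)\<^sup>2 - (a\<^sup>2 - 1) * (pell_y a n)\<^sup>2"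
    by (simp add: algebra_simps power2_eq_square)
  then show ?case using Suc by simp
qed simp

lemma pell_add:
  "pell_x a (m + n) = pell_x a m * pell_x a n + (a\<^sup>2 - 1) * pell_y a m * pell_y a n"
  "pell_y a (m + n) = pell_x a m * pell_y a n + pell_y a m * pell_x a n"
proof (induction m)
  case (Suc m)
  {
    case 1
    show ?case by (simp add: Suc.IH algebra_simps)
  next
    case 2
    show ?case by (simp add: Suc.IH algebra_simps)
  }
qed simp_all

text \<open>Units of norm 1 are inverted by conjugation, which turns the plus sign of the addition
  formula into a minus sign.\<close>

lemma pell_x_diff:
  assumes "n \<le> m"
  shows "pell_x a (m - n) = pell_x a m * pell_x a n - (a\<^sup>2 - 1) * pell_y a m * pell_y a n"
proof -
  obtain k where k: "m = k + n" using assms by (metis le_add_diff_inverse2)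
  have "pell_x a k = pell_x a k * ((pell_x a n)\<^sup>2 - (a\<^sup>2 - 1) * (pell_y a n)\<^sup>2)"
    using pell_eq[of a n] by simp
  then show ?thesis
    unfolding k pell_add add_diff_cancel_right' by (simp add: algebra_simps power2_eq_square)
qed

lemma pell_double:
  "pell_x a (2 * n) = 2 * (pell_x a n)\<^sup>2 - 1" "pell_y a (2 * n) = 2 * pell_x a n * pell_y a n"
  using pell_eq[of a n] unfolding mult_2[of n] pell_add
  by (simp_all add: power2_eq_square algebra_simps)

lemma pell_nonneg: "a \<ge> 1 \<Longrightarrow> pell_x a n \<ge> 1 \<and> pell_y a n \<ge> 0"
proof (induction n)
  case (Suc n)
  have "a\<^sup>2 - 1 \<ge> 0" using Suc.prems by (simp add: one_le_power)
  then have "(a\<^sup>2 - 1) * pell_y a n \<ge> 0" using Suc by simp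
  moreover have "a * pell_x a n \<ge> 1 * 1" using Suc by (intro mult_mono) auto
  moreover have "a * pell_y a n \<ge> 0" using Suc by simp
  ultimately show ?case using Suc unfolding pell_x.simps pell_y.simps by linarith
qed simp

lemma pell_x_ge: "a \<ge> 1 \<Longrightarrow> pell_x a n \<ge> 1" and pell_y_ge: "a \<ge> 1 \<Longrightarrow> pell_y a n \<ge> 0"
  using pell_nonneg by auto

lemma pell_y_less: assumes "a \<ge> 1" "m < n" shows "pell_y a m < pell_y a n"
  using assms(2)
proof (induction rule: less_Suc_induct)
  case (1 i)
  have "1 * pell_y a i \<le> a * pell_y a i"
    using assms(1) pell_y_ge[OF assms(1)] by (intro mult_mono) auto
  then show ?case using pell_x_ge[OF assms(1), of i] by simp
qed simp

lemma pell_x_Suc_ge: assumes "a \<ge> 1" shows "a * pell_x a n \<le> pell_x a (Suc n)"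
proof -
  have "a\<^sup>2 - 1 \<ge> 0" using assms by (simp add: one_le_power)
  then show ?thesis using pell_y_ge[OF assms, of n] by simp
qed

lemma pell_x_less: assumes "a \<ge> 2" "m < n" shows "pell_x a m < pell_x a n"
  using assms(2)
proof (induction rule: less_Suc_induct)
  case (1 i)
  have "2 * pell_x a i \<le> a * pell_x a i"
    using assms(1) pell_x_ge[of a i] by (intro mult_mono) auto
  then show ?case using pell_x_ge[of a i] pell_x_Suc_ge[of a i] assms by linarith
qed simp

lemma pell_x_inj: assumes "a \<ge> 2" "pell_x a m = pell_x a n" shows "m = n"
  using assms pell_x_less[of a m n] pell_x_less[of a n m] by (cases m n rule: linorder_cases) auto

lemma pell_y_ge_index: assumes "a \<ge> 1" shows "pell_y a n \<ge> int n"
proof (induction n)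
  case (Suc n)
  then show ?case using pell_y_less[OF assms, of n "Suc n"] by simp
qed simp

lemma pell_x_ge_power: assumes "a \<ge> 1" shows "pell_x a n \<ge> a ^ n"
proof (induction n)
  case (Suc n)
  have "a ^ Suc n \<le> a * pell_x a n" using Suc assms by (simp add: mult_left_mono)
  then show ?case using pell_x_Suc_ge[OF assms, of n] by linarith
qed simp

text \<open>Descent on \<open>y\<close>: dividing a solution by the fundamental unit gives a
  nonnegative solution with smaller \<open>y\<close>, until \<open>y = 0\<close> is reached.\<close>

lemma pell_complete:
  assumes "a \<ge> 1" "x \<ge> 0" "y \<ge> 0" "x\<^sup>2 = (a\<^sup>2 - 1) * y\<^sup>2 + 1"
  shows "\<exists>n. x = pell_x a n \<and> y = pell_y a n"
  using assms(2-4)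
proof (induction "nat y" arbitrary: x y rule: less_induct)
  case less
  note eq = less.prems(3)
  show ?case
  proof (cases "y = 0")
    case True
    then have "x = 1" using less.prems by (simp add: power2_eq_1_iff)
    then show ?thesis using True by (intro exI[of _ 0]) simp
  next
    case False
    then have y: "y \<ge> 1" using less.prems by simp
    have y2: "y\<^sup>2 \<ge> 1" using y by (simp add: one_le_power)
    \<comment> \<open>The coefficients of
      \<open>(x + y * sqrt (a\<^sup>2 - 1)) * (a - sqrt (a\<^sup>2 - 1))\<close>.\<close>
    define x' y' where "x' = a * x - (a\<^sup>2 - 1) * y" and "y' = a * y - x"
    have "x\<^sup>2 \<le> (a * y)\<^sup>2" using eq y2 by (simp add: power_mult_distrib algebra_simps)
    moreover have "0 \<le> a * y" using assms(1) y by simp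
    ultimately have y'0: "y' \<ge> 0" unfolding y'_def using power2_le_imp_le by fastforce
    have "(a - 1)\<^sup>2 \<le> a\<^sup>2 - 1" using assms(1) by (simp add: power2_eq_square algebra_simps)
    then have "((a - 1) * y)\<^sup>2 < x\<^sup>2" using eq mult_right_mono[of "(a - 1)\<^sup>2" "a\<^sup>2 - 1" "y\<^sup>2"]
      unfolding power_mult_distrib by simp
    then have "(a - 1) * y < x" using less.prems(1) by (rule power2_less_imp_less)
    then have y'y: "y' < y" unfolding y'_def by (simp add: algebra_simps)
    have "((a\<^sup>2 - 1) * y)\<^sup>2 = (a\<^sup>2 - 1) * ((a\<^sup>2 - 1) * y\<^sup>2)" by (simp add: power2_eq_square)
    also have "\<dots> = (a\<^sup>2 - 1) * (x\<^sup>2 - 1)" using eq by simp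
    also have "\<dots> \<le> (a * x)\<^sup>2"
    proof -
      have "(a * x)\<^sup>2 - (a\<^sup>2 - 1) * (x\<^sup>2 - 1) = a\<^sup>2 - 1 + x\<^sup>2"
        by (simp add: power2_eq_square algebra_simps)
      moreover have "a\<^sup>2 \<ge> 1" using assms(1) by (simp add: one_le_power)
      ultimately show ?thesis using zero_le_power2[of x] by linarith
    qed
    finally have "(a\<^sup>2 - 1) * y \<le> a * x"
      by (rule power2_le_imp_le) (use assms(1) less.prems in auto)
    then have x'0: "x' \<ge> 0" by (simp add: x'_def)
    have "x'\<^sup>2 - (a\<^sup>2 - 1) * y'\<^sup>2 = x\<^sup>2 - (a\<^sup>2 - 1) * y\<^sup>2"
      unfolding x'_def y'_def by (simp add: power2_eq_square algebra_simps)
    then have eq': "x'\<^sup>2 = (a\<^sup>2 - 1) * y'\<^sup>2 + 1" using eq by simp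
    obtain n where n: "x' = pell_x a n" "y' = pell_y a n"
      using less.hyps[OF _ x'0 y'0 eq'] y'y y by auto
    have "x = pell_x a (Suc n)" "y = pell_y a (Suc n)"
      unfolding pell_x.simps pell_y.simps n[symmetric] x'_def y'_def
      by (simp_all add: power2_eq_square algebra_simps)
    then show ?thesis by blast
  qed
qed

section \<open>Congruences and divisibility of Pell solutions\<close>

lemma pell_x_cong_base:
  assumes "[a = b] (mod c)"
  shows "[pell_x a n = pell_x b n] (mod c)" "[pell_y a n = pell_y b n] (mod c)"
  by (induction n) (auto intro!: cong_add cong_mult cong_diff cong_pow assms)

text \<open>For base 1 the second sequence is \<open>n\<close> itself, and \<open>a\<close> is
  congruent to 1 modulo \<open>a - 1\<close>. Thus a value reveals its index modulo
  \<open>a - 1\<close>.\<close>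

lemma pell_y_cong_index: "[pell_y a n = int n] (mod (a - 1))"
proof -
  have a: "[a = 1] (mod (a - 1))" by (simp add: cong_iff_dvd_diff)
  have *: "pell_x 1 n = 1 \<and> pell_y 1 n = int n" by (induction n) auto
  show ?thesis using pell_x_cong_base(2)[OF a, of n] * by simp
qed

lemma pell_coprime: "coprime (pell_x a n) (pell_y a n)"
proof (rule coprimeI)
  fix c assume c: "c dvd pell_x a n" "c dvd pell_y a n"
  have "c dvd (pell_x a n)\<^sup>2 - (a\<^sup>2 - 1) * (pell_y a n)\<^sup>2"
    using c by (simp add: power2_eq_square)
  then show "is_unit c" using pell_eq[of a n] by simp
qed

lemma pell_y_dvd_mult: "pell_y a n dvd pell_y a (n * q)"
  by (induction q) (auto simp: pell_add)

text \<open>The addition formula reduces \<open>m\<close> to its remainder modulo \<open>n\<close>,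
  because the cofactor \<open>pell_x a (n * q)\<close> is coprime to \<open>pell_y a n\<close>. The
  remainder has too small a value to be a nonzero multiple.\<close>

lemma pell_y_dvd_imp_dvd:
  assumes "a \<ge> 1" "n \<ge> 1" "pell_y a n dvd pell_y a m"
  shows "n dvd m"
proof -
  define q r where "q = m div n" and "r = m mod n"
  have m: "m = n * q + r" by (simp add: q_def r_def)
  have *: "pell_y a n dvd pell_y a (n * q)" by (rule pell_y_dvd_mult)
  have "pell_y a n dvd pell_x a (n * q) * pell_y a r"
    using assms(3) * unfolding m pell_add by (simp add: dvd_add_left_iff)
  moreover have "coprime (pell_y a n) (pell_x a (n * q))"
    using * pell_coprime[of a "n * q"] by (metis coprime_commute coprime_divisors dvd_refl)
  ultimately have "pell_y a n dvd pell_y a r" by (simp add: coprime_dvd_mult_right_iff)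
  moreover have "pell_y a r < pell_y a n"
    using assms by (intro pell_y_less) (auto simp: r_def)
  ultimately have "pell_y a r = 0" using pell_y_ge[OF assms(1), of r] zdvd_imp_le by fastforce
  then have "r = 0" using pell_y_ge_index[OF assms(1), of r] by simp
  then show ?thesis using m by simp
qed

text \<open>Binomial expansion of the \<open>q\<close>-th power of
  \<open>pell_x a n + pell_y a n * sqrt (a\<^sup>2 - 1)\<close>: modulo the square of
  \<open>pell_y a n\<close> only the first two terms survive. The extra factor
  \<open>pell_x a n\<close> in the second congruence avoids the exponent
  \<open>q - 1\<close>.\<close>

lemma pell_mult_cong:
  "[pell_x a (n * q) = pell_x a n ^ q] (mod (pell_y a n)\<^sup>2)"
  "[pell_x a n * pell_y a (n * q) = int q * pell_x a n ^ q * pell_y a n] (mod (pell_y a n)\<^sup>2)"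
proof (induction q)
  case (Suc q)
  let ?x = "pell_x a n" and ?y = "pell_y a n"
  have yq: "?y dvd pell_y a (n * q)" by (rule pell_y_dvd_mult)
  have e: "n * Suc q = n * q + n" by simp
  {
    case 1
    have "?y\<^sup>2 dvd (a\<^sup>2 - 1) * pell_y a (n * q) * ?y"
      using yq by (simp add: power2_eq_square mult_dvd_mono)
    then have "[(a\<^sup>2 - 1) * pell_y a (n * q) * ?y = 0] (mod ?y\<^sup>2)" by (simp add: cong_0_iff)
    then have "[pell_x a (n * q) * ?x + (a\<^sup>2 - 1) * pell_y a (n * q) * ?y = ?x ^ q * ?x + 0] (mod ?y\<^sup>2)"
      by (intro cong_add cong_mult Suc.IH) auto
    then show ?case unfolding e pell_add by (simp add: mult.commute)
  next
    case 2
    have "[?x * pell_y a (n * Suc q) = pell_x a (n * q) * (?x * ?y) + (?x * pell_y a (n * q)) * ?x] (mod ?y\<^sup>2)"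
      unfolding e pell_add by (simp add: algebra_simps)
    also have "[pell_x a (n * q) * (?x * ?y) + (?x * pell_y a (n * q)) * ?x
        = ?x ^ q * (?x * ?y) + (int q * ?x ^ q * ?y) * ?x] (mod ?y\<^sup>2)"
      by (intro cong_add cong_mult Suc.IH) auto
    finally show ?case by (simp add: algebra_simps)
  }
qed simp_all

text \<open>With \<open>m = n * q\<close>, the square divides the linear term
  \<open>int q * pell_x a n ^ q * pell_y a n\<close>, so \<open>pell_y a n\<close> divides
  \<open>q\<close>. This turns a condition on values into one on indices.\<close>

lemma pell_y_sq_dvd:
  assumes "a \<ge> 1" "n \<ge> 1" "(pell_y a n)\<^sup>2 dvd pell_y a m"
  shows "pell_y a n dvd int m"
proof -
  let ?x = "pell_x a n" and ?y = "pell_y a n"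
  have y: "?y > 0" using pell_y_ge_index[OF assms(1), of n] assms(2) by simp
  have "?y dvd pell_y a m" using assms(3) by (metis dvd_mult_left power2_eq_square)
  then obtain q where q: "m = n * q" using pell_y_dvd_imp_dvd[OF assms(1,2)] by blast
  have "?y\<^sup>2 dvd ?x * pell_y a (n * q)" using assms(3) q by simp
  then have "?y\<^sup>2 dvd int q * ?x ^ q * ?y" using pell_mult_cong(2)[of a n q] by (simp add: cong_dvd_iff)
  then have "?y dvd int q * ?x ^ q" using y by (simp add: power2_eq_square)
  moreover have "coprime ?y (?x ^ q)" using pell_coprime[of a n] by (simp add: coprime_commute)
  ultimately have "?y dvd int q" by (simp add: coprime_dvd_mult_left_iff)
  then show ?thesis using q by simp
qed

lemma pell_y_sq_dvd_mult:
  assumes "int k = pell_y a n" shows "(pell_y a n)\<^sup>2 dvd pell_y a (n * k)"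
proof -
  have "(pell_y a n)\<^sup>2 dvd int k * pell_x a n ^ k * pell_y a n"
    unfolding assms by (simp add: power2_eq_square)
  then have "(pell_y a n)\<^sup>2 dvd pell_x a n * pell_y a (n * k)"
    using pell_mult_cong(2)[of a n k] by (simp add: cong_dvd_iff)
  moreover have "coprime ((pell_y a n)\<^sup>2) (pell_x a n)"
    using pell_coprime[of a n] by (simp add: coprime_commute)
  ultimately show ?thesis by (simp add: coprime_dvd_mult_right_iff)
qed

section \<open>Period of the first sequence modulo one of its values\<close>

lemma pell_x_2n_add: "[pell_x a (2 * n + j) = - pell_x a j] (mod pell_x a n)"
proof -
  have "pell_x a (2 * n + j) - - pell_x a j = pell_x a n *
      (2 * pell_x a n * pell_x a j + (a\<^sup>2 - 1) * 2 * pell_y a n * pell_y a j)"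
    unfolding pell_add(1) pell_double by (simp add: algebra_simps power2_eq_square)
  then show ?thesis by (simp add: cong_iff_dvd_diff)
qed

lemma pell_x_2n_diff:
  assumes "j \<le> 2 * n" shows "[pell_x a (2 * n - j) = - pell_x a j] (mod pell_x a n)"
proof -
  have "pell_x a (2 * n - j) - - pell_x a j = pell_x a n *
      (2 * pell_x a n * pell_x a j - (a\<^sup>2 - 1) * 2 * pell_y a n * pell_y a j)"
    unfolding pell_x_diff[OF assms] pell_double by (simp add: algebra_simps power2_eq_square)
  then show ?thesis by (simp add: cong_iff_dvd_diff)
qed

text \<open>Modulo \<open>pell_x a n\<close>, shifting the index by \<open>2 * n\<close> changes the
  sign; two such shifts cancel.\<close>

lemma pell_x_4n_add: "[pell_x a (4 * n * q + j) = pell_x a j] (mod pell_x a n)"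
proof (induction q)
  case (Suc q)
  have "[pell_x a (2 * n + (2 * n + (4 * n * q + j))) = - pell_x a (2 * n + (4 * n * q + j))] (mod pell_x a n)"
    by (rule pell_x_2n_add)
  also have "[- pell_x a (2 * n + (4 * n * q + j)) = - (- pell_x a (4 * n * q + j))] (mod pell_x a n)"
    using pell_x_2n_add by (simp only: cong_minus_minus_iff)
  also have "- (- pell_x a (4 * n * q + j)) = pell_x a (4 * n * q + j)" by simp
  also note Suc
  finally show ?case by (simp add: algebra_simps)
qed simp

lemma pell_x_cong_small:
  assumes "a \<ge> 3" "i \<le> n" "j \<le> n" "[pell_x a i = pell_x a j] (mod pell_x a n)"
  shows "i = j"
proof -
  have le: "pell_x a k \<le> pell_x a n" if "k \<le> n" for k
    using that pell_x_less[of a k n] assms(1) by (cases "k = n") auto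
  have "pell_x a n dvd pell_x a i - pell_x a j" using assms(4) by (simp add: cong_iff_dvd_diff)
  moreover have "\<bar>pell_x a i - pell_x a j\<bar> < \<bar>pell_x a n\<bar>"
    using le[OF assms(2)] le[OF assms(3)] pell_x_ge[of a i] pell_x_ge[of a j] assms(1) by simp
  ultimately have "pell_x a i - pell_x a j = 0" using dvd_imp_le_int leD by blast
  then show ?thesis using pell_x_inj[of a i j] assms(1) by simp
qed

text \<open>As \<open>a \<ge> 3\<close>, every value of smaller index is at most a third of
  \<open>pell_x a n\<close>, so the sum of two values of index up to \<open>n\<close> is a multiple
  of it only if both indices are \<open>n\<close>.\<close>

lemma pell_x_cong_neg_small:
  assumes "a \<ge> 3" "i \<le> n" "j \<le> n" "[pell_x a i = - pell_x a j] (mod pell_x a n)"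
  shows "i = n \<and> j = n"
proof -
  have pos: "pell_x a k \<ge> 1" for k using assms(1) by (simp add: pell_x_ge)
  have d: "pell_x a n dvd pell_x a i + pell_x a j" using assms(4) by (simp add: cong_iff_dvd_diff)
  have le: "3 * pell_x a k \<le> pell_x a n" if "k < n" for k
  proof -
    have "3 * pell_x a k \<le> a * pell_x a k" using assms(1) pos by (intro mult_right_mono) (auto simp: order_trans[OF _ pos])
    also have "\<dots> \<le> pell_x a (Suc k)" using pell_x_Suc_ge[of a k] assms(1) by simp
    also have "\<dots> \<le> pell_x a n" using that pell_x_less[of a "Suc k" n] assms(1) by (cases "Suc k = n") auto
    finally show ?thesis .
  qed
  have e: "k = n" if "k \<le> n" "l \<le> n" "pell_x a n dvd pell_x a k + pell_x a l" for k l
  proof (rule ccontr)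
    assume "k \<noteq> n"
    then have k: "3 * pell_x a k \<le> pell_x a n" using that by (intro le) auto
    show False
    proof (cases "l = n")
      case True
      then have "pell_x a n dvd pell_x a k" using that(3) by (simp add: dvd_add_left_iff)
      then show False using k pos[of k] zdvd_imp_le by fastforce
    next
      case False
      then have l: "3 * pell_x a l \<le> pell_x a n" using that by (intro le) auto
      show False using that(3) zdvd_imp_le[OF that(3)] k l pos[of k] pos[of l] by linarith
    qed
  qed
  show ?thesis using e[OF assms(2,3) d] e[OF assms(3,2)] d by (simp add: add.commute)
qed

text \<open>Over a period of \<open>4 * n\<close>, the indices from \<open>n\<close> to
  \<open>3 * n\<close> carry negatives of small values, and the last quarter repeats the first one
  backwards. Hence only \<open>i\<close> and \<open>4 * n - i\<close> share a residue.\<close>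

lemma pell_x_cong_index:
  assumes "a \<ge> 3" "n \<ge> 1" "i \<le> n" "[pell_x a j = pell_x a i] (mod pell_x a n)"
  shows "[int j = int i] (mod (4 * int n)) \<or> [int j = - int i] (mod (4 * int n))"
proof -
  define q r where "q = j div (4 * n)" and "r = j mod (4 * n)"
  have j: "j = 4 * n * q + r" by (simp add: q_def r_def)
  have r: "r < 4 * n" using assms(2) by (simp add: r_def)
  have jr: "[int j = int r] (mod (4 * int n))" unfolding j by (simp add: cong_iff_dvd_diff)
  have c: "[pell_x a r = pell_x a i] (mod pell_x a n)"
    using pell_x_4n_add[of a n q r] assms(4) unfolding j by (metis cong_sym cong_trans)
  have neg: "[pell_x a i = - pell_x a k] (mod pell_x a n)"
    if "[pell_x a r = - pell_x a k] (mod pell_x a n)" for k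
    using that c by (metis cong_sym cong_trans)
  consider "r \<le> n" | "n < r" "r \<le> 2 * n" | "2 * n < r" "r \<le> 3 * n" | "3 * n < r" by linarith
  then show ?thesis
  proof cases
    case 1
    then have "r = i" using pell_x_cong_small[OF assms(1) 1 assms(3) c] by simp
    then show ?thesis using jr by simp
  next
    case 2
    have "[pell_x a (2 * n - (2 * n - r)) = - pell_x a (2 * n - r)] (mod pell_x a n)"
      by (rule pell_x_2n_diff) simp
    then have "[pell_x a r = - pell_x a (2 * n - r)] (mod pell_x a n)" using 2 by simp
    from pell_x_cong_neg_small[OF assms(1,3) _ neg[OF this]] have False using 2 by linarith
    then show ?thesis ..
  next
    case 3
    have "[pell_x a (2 * n + (r - 2 * n)) = - pell_x a (r - 2 * n)] (mod pell_x a n)"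
      by (rule pell_x_2n_add)
    then have "[pell_x a r = - pell_x a (r - 2 * n)] (mod pell_x a n)" using 3 by simp
    \<comment> \<open>The boundary case: \<open>3 * n\<close> is \<open>4 * n - n\<close>, the
      negative of \<open>i = n\<close>.\<close>
    from pell_x_cong_neg_small[OF assms(1,3) _ neg[OF this]] have "i = n" "r = 3 * n" using 3 by linarith+
    then have "[int r = - int i] (mod (4 * int n))" by (simp add: cong_iff_dvd_diff)
    then show ?thesis using jr cong_trans by blast
  next
    case 4
    have "[pell_x a (2 * n + (r - 2 * n)) = - pell_x a (r - 2 * n)] (mod pell_x a n)"
      by (rule pell_x_2n_add)
    moreover have "[pell_x a (2 * n - (4 * n - r)) = - pell_x a (4 * n - r)] (mod pell_x a n)"
      using 4 by (intro pell_x_2n_diff) simp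
    ultimately have "[pell_x a r = - (- pell_x a (4 * n - r))] (mod pell_x a n)"
      using 4 r by (simp add: diff_diff_right) (metis add.inverse_inverse cong_minus_minus_iff cong_trans)
    then have "[pell_x a (4 * n - r) = pell_x a i] (mod pell_x a n)" using c 
      by (metis add.inverse_inverse cong_sym cong_trans)
    then have "4 * n - r = i" using 4 by (intro pell_x_cong_small[OF assms(1) _ assms(3)]) auto
    then have "int r - - int i = 4 * int n" using r by auto
    then have "[int r = - int i] (mod (4 * int n))" unfolding cong_iff_dvd_diff by simp
    then show ?thesis using jr cong_trans by blast
  qed
qed

section \<open>Recognising the Pell solution with a given index\<close>

lemma pell_complete_nat:
  fixes a x y :: nat
  assumes "a \<ge> 1" "x * x + y * y = a * a * y * y + 1"
  obtains n where "int x = pell_x (int a) n" "int y = pell_y (int a) n"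
proof -
  have "int (x * x + y * y) = int (a * a * y * y + 1)" using assms(2) by simp
  then have "(int x)\<^sup>2 = ((int a)\<^sup>2 - 1) * (int y)\<^sup>2 + 1"
    by (simp add: power2_eq_square algebra_simps)
  then show ?thesis using pell_complete[of "int a" "int x" "int y"] assms(1) that by auto
qed

lemma pell_eq_nat:
  fixes a x y :: nat
  assumes "int x = pell_x (int a) n" "int y = pell_y (int a) n"
  shows "x * x + y * y = a * a * y * y + 1"
proof -
  have "(int x)\<^sup>2 = ((int a)\<^sup>2 - 1) * (int y)\<^sup>2 + 1" using pell_eq assms by simp
  then have "int (x * x + y * y) = int (a * a * y * y + 1)"
    by (simp add: power2_eq_square algebra_simps)
  then show ?thesis by (simp only: of_nat_eq_iff)
qed

lemma cong_le_imp_eq: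
  fixes i k y :: nat
  assumes "1 \<le> k" "k \<le> y" "1 \<le> i" "i \<le> y"
    and "[int k = int i] (mod (4 * int y)) \<or> [int k = - int i] (mod (4 * int y))"
  shows "k = i"
proof -
  consider "4 * int y dvd int k - int i" | "4 * int y dvd int k + int i"
    using assms(5) by (auto simp: cong_iff_dvd_diff)
  then show ?thesis
  proof cases
    case 1
    then have "int k - int i = 0" using assms dvd_imp_le_int[OF _ 1] by linarith
    then show ?thesis by simp
  next
    case 2
    then show ?thesis using assms zdvd_imp_le[OF 2] by linarith
  qed
qed

lemma cong_1_imp_pos:
  fixes b y :: nat
  assumes "[b = 1] (mod 4 * y)"
  shows "b \<ge> 1"
proof (rule ccontr)
  assume "\<not> b \<ge> 1"
  then have "[1 = 0] (mod 4 * y)" using assms by (metis cong_sym less_one not_le)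
  then have "4 * y dvd 1" by (simp only: cong_0_iff)
  then show False by simp
qed

text \<open>The pair \<open>(x, y)\<close> has some index \<open>i\<close>, to be compared with
  \<open>k\<close>. By \<open>y * y dvd v\<close>, the index \<open>n\<close> of
  \<open>(u, v)\<close> is a multiple of \<open>y\<close>. Since \<open>b\<close> is congruent to
  \<open>a\<close> modulo \<open>u\<close>, the index \<open>j\<close> of \<open>(s, t)\<close>
  agrees with \<open>i\<close> up to sign modulo \<open>4 * n\<close>, hence modulo
  \<open>4 * y\<close>. Since \<open>b\<close> is congruent to 1 modulo \<open>4 * y\<close>, the
  index \<open>j\<close> is congruent to \<open>t\<close> and so to \<open>k\<close>. As
  \<open>i\<close> and \<open>k\<close> lie between 1 and \<open>y\<close>, they coincide.\<close>

theorem matiyasevich: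
  fixes a k x y :: nat
  assumes a: "a \<ge> 3" and k: "k \<ge> 1"
  shows "int x = pell_x (int a) k \<and> int y = pell_y (int a) k \<longleftrightarrow>
    k \<le> y \<and> (\<exists>u v s t b. x * x + y * y = a * a * y * y + 1 \<and> u * u + v * v = a * a * v * v + 1 \<and>
      s * s + t * t = b * b * t * t + 1 \<and> [b = 1] (mod 4 * y) \<and> [b = a] (mod u) \<and>
      1 \<le> v \<and> y * y dvd v \<and> [s = x] (mod u) \<and> [t = k] (mod 4 * y))"
    (is "?L \<longleftrightarrow> k \<le> y \<and> (\<exists>u v s t b. ?R u v s t b)")
proof (intro iffI)
  assume L: ?L
  then have xy: "int x = pell_x (int a) k" "int y = pell_y (int a) k" by auto
  have ky: "k \<le> y" using pell_y_ge_index[of "int a" k] a xy by simp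
  \<comment> \<open>The factor \<open>k * y\<close> makes \<open>v\<close> a multiple of
    \<open>y * y\<close>. The factor 2 makes \<open>v\<close> even, so that \<open>u\<close> is
    coprime to \<open>4 * y\<close> and \<open>b\<close> exists by the Chinese remainder
    theorem.\<close>
  define n where "n = 2 * (k * y)"
  have nn: "n \<ge> 1" using k ky by (simp add: n_def)
  define u v where "u = nat (pell_x (int a) n)" and "v = nat (pell_y (int a) n)"
  have uv: "int u = pell_x (int a) n" "int v = pell_y (int a) n"
    using a pell_x_ge[of "int a" n] pell_y_ge[of "int a" n] by (simp_all add: u_def v_def)
  have v1: "1 \<le> v" using pell_y_ge_index[of "int a" n] a nn uv by simp
  have "int (y * y) dvd int v"
  proof -
    have "(pell_y a k)\<^sup>2 dvd pell_y a (k * y)" using pell_y_sq_dvd_mult[of y a k] xy by simp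
    also have "pell_y a (k * y) dvd pell_y a n"
      unfolding n_def using pell_y_dvd_mult[of a "k * y" 2] by (simp add: mult.commute)
    finally show ?thesis using xy uv by (simp add: power2_eq_square)
  qed
  then have yv: "y * y dvd v" by (simp only: of_nat_dvd_iff)
  have ev: "2 dvd v"
  proof -
    have "2 dvd int v" unfolding uv n_def pell_double by simp
    then show ?thesis by (simp add: even_of_nat)
  qed
  have cuv: "coprime u v" using pell_coprime[of a n] uv by (metis coprime_int_iff)
  have cu: "coprime u (4 * y)"
  proof -
    have "coprime u 2" using cuv ev by (metis coprime_divisors dvd_refl)
    then have "coprime u (2\<^sup>2)" unfolding coprime_power_right_iff by blast
    moreover have "coprime u y" using cuv yv by (metis coprime_divisors dvd_refl dvd_mult_left)
    ultimately show ?thesis by simp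
  qed
  obtain b where b: "[b = 1] (mod 4 * y)" "[b = a] (mod u)"
    using binary_chinese_remainder_nat[of "4 * y" u 1 a] cu by (auto simp: coprime_commute)
  have "b \<ge> 1" using b(1) by (rule cong_1_imp_pos)
  define s t where "s = nat (pell_x (int b) k)" and "t = nat (pell_y (int b) k)"
  have st: "int s = pell_x (int b) k" "int t = pell_y (int b) k"
    using \<open>b \<ge> 1\<close> pell_x_ge[of "int b" k] pell_y_ge[of "int b" k] by (simp_all add: s_def t_def)
  have "[int b = int a] (mod int u)" using b(2) by (simp add: cong_int_iff)
  then have "[int s = int x] (mod int u)" unfolding st xy by (rule pell_x_cong_base)
  then have sx: "[s = x] (mod u)" by (simp add: cong_int_iff)
  have "int (4 * y) dvd int b - 1"
    using b(1) by (metis cong_iff_dvd_diff cong_int_iff of_nat_1)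
  then have "[int t = int k] (mod int (4 * y))"
    unfolding st using pell_y_cong_index by (rule cong_dvd_modulus[rotated])
  then have tk: "[t = k] (mod 4 * y)" by (simp only: cong_int_iff)
  show "k \<le> y \<and> (\<exists>u v s t b. ?R u v s t b)"
    using ky pell_eq_nat[OF xy] pell_eq_nat[OF uv] pell_eq_nat[OF st] b v1 yv sx tk by blast
next
  assume "k \<le> y \<and> (\<exists>u v s t b. ?R u v s t b)"
  then obtain u v s t b where ky: "k \<le> y" and R: "?R u v s t b" by blast
  have a1: "a \<ge> 1" using a by simp
  have b1: "b \<ge> 1" using R cong_1_imp_pos by blast
  obtain i where xy: "int x = pell_x (int a) i" "int y = pell_y (int a) i"
    using pell_complete_nat[OF a1, of x y] R by auto
  obtain n where uv: "int u = pell_x (int a) n" "int v = pell_y (int a) n"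
    using pell_complete_nat[OF a1, of u v] R by auto
  obtain j where st: "int s = pell_x (int b) j" "int t = pell_y (int b) j"
    using pell_complete_nat[OF b1, of s t] R by auto
  have i1: "i \<ge> 1" using xy(2) k ky by (cases i) auto
  have n1: "n \<ge> 1" using uv(2) R by (cases n) auto
  have iy: "i \<le> y" using pell_y_ge_index[of "int a" i] a xy by simp
  have yv: "(pell_y a i)\<^sup>2 dvd pell_y a n"
    using R unfolding xy[symmetric] uv[symmetric] by (metis of_nat_dvd_iff of_nat_mult power2_eq_square)
  have yn: "int y dvd int n" unfolding xy(2) using pell_y_sq_dvd[OF _ i1 yv] a by simp
  \<comment> \<open>Together with \<open>i \<le> y\<close> this puts \<open>i\<close> into the first
    quarter of the period, where residues determine the index.\<close>
  have "y \<le> n" using yn n1 by (simp add: dvd_imp_le)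
  have "i \<le> n" using iy \<open>y \<le> n\<close> by simp
  have "[int b = int a] (mod int u)" using R by (simp add: cong_int_iff)
  then have "[int s = pell_x (int a) j] (mod int u)" unfolding st by (rule pell_x_cong_base)
  moreover have "[int s = int x] (mod int u)" using R by (simp add: cong_int_iff)
  ultimately have "[pell_x (int a) j = pell_x (int a) i] (mod pell_x (int a) n)"
    unfolding xy uv by (metis cong_sym cong_trans)
  then have "[int j = int i] (mod (4 * int n)) \<or> [int j = - int i] (mod (4 * int n))"
    using pell_x_cong_index[of "int a" n i j] a n1 \<open>i \<le> n\<close> by simp
  moreover have "4 * int y dvd 4 * int n" using yn by simp
  ultimately have ji: "[int j = int i] (mod (4 * int y)) \<or> [int j = - int i] (mod (4 * int y))"
    using cong_dvd_modulus by blast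
  have "int (4 * y) dvd int b - 1"
    using R by (metis cong_iff_dvd_diff cong_int_iff of_nat_1)
  then have "[int t = int j] (mod int (4 * y))"
    unfolding st using pell_y_cong_index by (rule cong_dvd_modulus[rotated])
  moreover have "[int t = int k] (mod int (4 * y))" using R by (simp only: cong_int_iff)
  ultimately have kj: "[int k = int j] (mod (4 * int y))" by (metis cong_sym cong_trans of_nat_mult of_nat_numeral)
  have "[int k = int i] (mod (4 * int y)) \<or> [int k = - int i] (mod (4 * int y))"
    using ji kj cong_trans by blast
  then have "k = i" using cong_le_imp_eq[of k y i] k ky i1 iy by simp
  then show ?L using xy by simp
qed

text \<open>The modulus is zero exactly if \<open>(n - a)\<^sup>2 = a\<^sup>2 - 1\<close>. So
  \<open>n - a\<close> acts as a square root of \<open>a\<^sup>2 - 1\<close>, under which the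
  fundamental unit becomes \<open>n\<close>.\<close>

lemma pell_power_cong:
  "[pell_x a k - pell_y a k * (a - n) = n ^ k] (mod (2 * a * n - n\<^sup>2 - 1))"
proof (induction k)
  case (Suc k)
  have "pell_x a (Suc k) - pell_y a (Suc k) * (a - n)
      = n * (pell_x a k - pell_y a k * (a - n)) + (2 * a * n - n\<^sup>2 - 1) * pell_y a k"
    by (simp add: power2_eq_square algebra_simps)
  moreover have "[n * (pell_x a k - pell_y a k * (a - n)) + (2 * a * n - n\<^sup>2 - 1) * pell_y a k
      = n * n ^ k + 0] (mod (2 * a * n - n\<^sup>2 - 1))"
    by (intro cong_add cong_mult Suc) (auto simp: cong_0_iff)
  ultimately show ?case by simp
qed simp

text \<open>The congruence determines \<open>n ^ k\<close> once the modulus exceeds it, so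
  \<open>a\<close> has to beat \<open>n ^ k\<close> before powers are available. Another Pell value
  does this, as \<open>pell_x (int (n + 2)) k\<close> is at least \<open>(n + 2) ^ k\<close>; the
  shift by 2 makes this base at least 3.\<close>

lemma power_eq_iff_pell:
  fixes n k m :: nat
  assumes "n \<ge> 1" "k \<ge> 1"
  shows "m = n ^ k \<longleftrightarrow> (\<exists>a b x y t. int a = pell_x (int (n + 2)) k \<and> int b = pell_y (int (n + 2)) k \<and>
    int x = pell_x (int a) k \<and> int y = pell_y (int a) k \<and>
    t + n * n + 1 = 2 * a * n \<and> m < t \<and> [x + y * n = y * a + m] (mod t))"
    (is "_ \<longleftrightarrow> (\<exists>a b x y t. ?R a b x y t)")
proof -
  define a where "a = nat (pell_x (int (n + 2)) k)"
  define b where "b = nat (pell_y (int (n + 2)) k)"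
  define x where "x = nat (pell_x (int a) k)"
  define y where "y = nat (pell_y (int a) k)"
  define t where "t = 2 * a * n - n * n - 1"
  have ab: "int a = pell_x (int (n + 2)) k" "int b = pell_y (int (n + 2)) k"
    using pell_x_ge[of "int (n + 2)" k] pell_y_ge[of "int (n + 2)" k] by (simp_all add: a_def b_def)
  have "int ((n + 2) ^ k) \<le> int a" unfolding ab using pell_x_ge_power[of "int (n + 2)" k] by simp
  then have ge: "(n + 2) ^ k \<le> a" by (simp only: of_nat_le_iff)
  have "n ^ k < (n + 2) ^ k" using assms by (intro power_strict_mono) auto
  have "(n + 2) ^ 1 \<le> (n + 2) ^ k" using assms by (intro power_increasing) auto
  then have an: "n + 2 \<le> a" using ge by simp
  have xy: "int x = pell_x (int a) k" "int y = pell_y (int a) k"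
    using pell_x_ge[of "int a" k] pell_y_ge[of "int a" k] an by (simp_all add: x_def y_def)
  have "(n + 2) * n \<le> a * n" using an by (intro mult_right_mono) auto
  moreover have "a * 1 \<le> a * n" using assms by (intro mult_left_mono) auto
  moreover have "(n + 2) * n = n * n + 2 * n" "2 * a * n = a * n + a * n" by (simp_all add: algebra_simps)
  ultimately have le: "a + n * n + 2 * n \<le> 2 * a * n" by linarith
  then have t: "t + n * n + 1 = 2 * a * n" using assms by (simp add: t_def)
  have at: "a < t" using le t assms by linarith
  have tz: "int t = 2 * int a * int n - (int n)\<^sup>2 - 1"
  proof -
    have "int (t + n * n + 1) = int (2 * a * n)" using t by simp
    then show ?thesis by (simp add: power2_eq_square algebra_simps)
  qed
  have "[int x - int y * (int a - int n) = int n ^ k] (mod int t)"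
    unfolding tz xy by (rule pell_power_cong)
  then have "[int x - int y * (int a - int n) + int y * int a = int n ^ k + int y * int a] (mod int t)"
    by (rule cong_add) simp
  then have "[int (x + y * n) = int (y * a + n ^ k)] (mod int t)" by (simp add: algebra_simps)
  then have c: "[x + y * n = y * a + n ^ k] (mod t)" by (simp only: cong_int_iff)
  have lt: "n ^ k < t" using \<open>n ^ k < (n + 2) ^ k\<close> ge at by linarith
  show ?thesis
  proof
    assume "m = n ^ k"
    then have "?R a b x y t" using ab xy t lt c by blast
    then show "\<exists>a b x y t. ?R a b x y t" by blast
  next
    assume "\<exists>a b x y t. ?R a b x y t"
    then obtain a' b' x' y' t' where R: "?R a' b' x' y' t'" by blast
    then have "a' = a" "b' = b" using ab by simp_all
    then have "int x' = int x" "int y' = int y" using R xy by metis+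
    then have "x' = x" "y' = y" by simp_all
    have "t' = t" using R t \<open>a' = a\<close> by simp
    have "[x + y * n = y * a + m] (mod t)" "m < t"
      using R \<open>a' = a\<close> \<open>x' = x\<close> \<open>y' = y\<close> \<open>t' = t\<close> by auto
    then have "[y * a + m = y * a + n ^ k] (mod t)" using c by (metis cong_sym cong_trans)
    then have "[m = n ^ k] (mod t)" by (simp add: cong_add_lcancel_nat)
    then show "m = n ^ k" using \<open>m < t\<close> lt by (simp add: cong_less_modulus_unique_nat)
  qed
qed

section \<open>Diophantine relations\<close>

text \<open>Polynomial equations are flattened to single operations: each atom later becomes one
  bilinear equation, and a bound on its variables bounds both of its sides.\<close>

datatype 'v atom = Const_Eq 'v nat | Plus_Eq 'v 'v 'v | Times_Eq 'v 'v 'v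

primrec sat :: "('v \<Rightarrow> nat) \<Rightarrow> 'v atom \<Rightarrow> bool" where
  "sat e (Const_Eq x c) \<longleftrightarrow> e x = c"
| "sat e (Plus_Eq x y z) \<longleftrightarrow> e x + e y = e z"
| "sat e (Times_Eq x y z) \<longleftrightarrow> e x * e y = e z"

lemma sat_map_atom: "sat e (map_atom f A) \<longleftrightarrow> sat (\<lambda>v. e (f v)) A"
  by (cases A) auto

text \<open>The variables \<open>Inl i\<close> are the free ones, the variables \<open>Inr j\<close> are existentially quantified.
  Disjunctions are never needed, so that systems of atoms suffice.\<close>

definition dioph :: "((nat \<Rightarrow> nat) \<Rightarrow> bool) \<Rightarrow> bool" where
  "dioph R \<longleftrightarrow>
    (\<exists>S :: (nat + nat) atom list. \<forall>e. R e \<longleftrightarrow> (\<exists>h. \<forall>A\<in>set S. sat (case_sum e h) A))"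

lemma diophI:
  fixes S :: "(nat + nat) atom list"
  assumes "\<And>e. R e \<longleftrightarrow> (\<exists>h. \<forall>A\<in>set S. sat (case_sum e h) A)"
  shows "dioph R"
proof -
  have "\<forall>e. R e \<longleftrightarrow> (\<exists>h. \<forall>A\<in>set S. sat (case_sum e h) A)" using assms by blast
  then show ?thesis unfolding dioph_def by (rule exI)
qed

lemma interleaving_exists:
  fixes h h' :: "nat \<Rightarrow> nat"
  shows "\<exists>g. (\<forall>j. g (2 * j) = h j) \<and> (\<forall>j. g (Suc (2 * j)) = h' j)"
  by (rule exI[of _ "\<lambda>j. if even j then h (j div 2) else h' (j div 2)"]) simp

lemma dioph_rename:
  assumes "dioph R" shows "dioph (\<lambda>e. R (\<lambda>i. e (\<rho> i)))"
proof -
  obtain S :: "(nat + nat) atom list"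
    where S: "\<And>e. R e \<longleftrightarrow> (\<exists>h. \<forall>A\<in>set S. sat (case_sum e h) A)"
    using assms unfolding dioph_def by blast
  have *: "(\<lambda>v. case_sum e h (map_sum \<rho> id v)) = case_sum (\<lambda>i. e (\<rho> i)) h"
    for e h :: "nat \<Rightarrow> nat" by (auto split: sum.split)
  show ?thesis
    by (rule diophI[where S = "map (map_atom (map_sum \<rho> id)) S"])
      (simp add: S sat_map_atom *)
qed

lemma dioph_conj:
  assumes "dioph P" "dioph Q" shows "dioph (\<lambda>e. P e \<and> Q e)"
proof -
  obtain S :: "(nat + nat) atom list"
    where S: "\<And>e. P e \<longleftrightarrow> (\<exists>h. \<forall>A\<in>set S. sat (case_sum e h) A)"
    using assms(1) unfolding dioph_def by blast
  obtain S' :: "(nat + nat) atom list"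
    where S': "\<And>e. Q e \<longleftrightarrow> (\<exists>h. \<forall>A\<in>set S'. sat (case_sum e h) A)"
    using assms(2) unfolding dioph_def by blast
  let ?l = "map_sum id (\<lambda>j. 2 * j) :: nat + nat \<Rightarrow> nat + nat"
  let ?r = "map_sum id (\<lambda>j. Suc (2 * j)) :: nat + nat \<Rightarrow> nat + nat"
  have l: "(\<lambda>v. case_sum e h (?l v)) = case_sum e (\<lambda>j. h (2 * j))"
    and r: "(\<lambda>v. case_sum e h (?r v)) = case_sum e (\<lambda>j. h (Suc (2 * j)))"
    for e h :: "nat \<Rightarrow> nat" by (auto split: sum.split)
  show ?thesis
  proof (rule diophI[where S = "map (map_atom ?l) S @ map (map_atom ?r) S'"])
    fix e
    have "P e \<and> Q e \<longleftrightarrow> (\<exists>h. (\<forall>A\<in>set S. sat (case_sum e (\<lambda>j. h (2 * j))) A) \<and>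
        (\<forall>A\<in>set S'. sat (case_sum e (\<lambda>j. h (Suc (2 * j)))) A))" (is "_ \<longleftrightarrow> (\<exists>h. ?C h)")
    proof
      assume "P e \<and> Q e"
      then obtain h h' where h: "\<forall>A\<in>set S. sat (case_sum e h) A" "\<forall>A\<in>set S'. sat (case_sum e h') A"
        using S S' by blast
      obtain g where g: "\<And>j. g (2 * j) = h j" "\<And>j. g (Suc (2 * j)) = h' j"
        using interleaving_exists[of h h'] by blast
      show "\<exists>h. ?C h" using h by (intro exI[of _ g]) (simp only: g)
    qed (use S S' in blast)
    then show "P e \<and> Q e \<longleftrightarrow>
        (\<exists>h. \<forall>A\<in>set (map (map_atom ?l) S @ map (map_atom ?r) S'). sat (case_sum e h) A)"
      by (simp only: sat_map_atom l r ball_Un set_append set_map ball_simps)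
  qed
qed

text \<open>A whole sequence is quantified at once, since the number of codes in the elimination of
  bounded quantifiers varies with the system of atoms.\<close>

lemma dioph_exs:
  assumes "dioph R"
  shows "dioph (\<lambda>e. \<exists>h. R (\<lambda>i. if even i then e (i div 2) else h (i div 2)))"
proof -
  obtain S :: "(nat + nat) atom list"
    where S: "\<And>e. R e \<longleftrightarrow> (\<exists>h. \<forall>A\<in>set S. sat (case_sum e h) A)"
    using assms unfolding dioph_def by blast
  let ?s = "case_sum (\<lambda>i. if even i then Inl (i div 2) else Inr (2 * (i div 2))) (\<lambda>j. Inr (Suc (2 * j)))
    :: nat + nat \<Rightarrow> nat + nat"
  have s: "(\<lambda>v. case_sum e h (?s v)) =
      case_sum (\<lambda>i. if even i then e (i div 2) else h (2 * (i div 2))) (\<lambda>j. h (Suc (2 * j)))"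
    for e h :: "nat \<Rightarrow> nat" by (auto split: sum.split)
  show ?thesis
  proof (rule diophI[where S = "map (map_atom ?s) S"])
    fix e
    have "(\<exists>h. R (\<lambda>i. if even i then e (i div 2) else h (i div 2))) \<longleftrightarrow>
      (\<exists>h. \<forall>A\<in>set S. sat (case_sum (\<lambda>i. if even i then e (i div 2) else h (2 * (i div 2)))
        (\<lambda>j. h (Suc (2 * j)))) A)" (is "?L \<longleftrightarrow> (\<exists>h. ?C h)")
    proof
      assume ?L
      then obtain h h' where
        h: "\<forall>A\<in>set S. sat (case_sum (\<lambda>i. if even i then e (i div 2) else h (i div 2)) h') A"
        using S by blast
      obtain g where g: "\<And>j. g (2 * j) = h j" "\<And>j. g (Suc (2 * j)) = h' j"
        using interleaving_exists[of h h'] by blast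
      show "\<exists>h. ?C h" using h by (intro exI[of _ g]) (simp only: g)
    next
      assume "\<exists>h. ?C h"
      then obtain h where "?C h" by blast
      then have "R (\<lambda>i. if even i then e (i div 2) else h (2 * (i div 2)))" using S by blast
      then show ?L by (rule exI[where x = "\<lambda>i. h (2 * i)"])
    qed
    then show "(\<exists>h. R (\<lambda>i. if even i then e (i div 2) else h (i div 2))) \<longleftrightarrow>
      (\<exists>h. \<forall>A\<in>set (map (map_atom ?s) S). sat (case_sum e h) A)"
      by (simp only: sat_map_atom s set_map ball_simps)
  qed
qed

text \<open>Quantifiers follow de Bruijn: the bound variable is \<open>e 0\<close>, and all others
  move up by one.\<close>

lemma dioph_ex:
  assumes "dioph (\<lambda>e. P (e 0) (\<lambda>i. e (Suc i)))"
  shows "dioph (\<lambda>e. \<exists>x. P x e)"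
proof -
  \<comment> \<open>The bound variable goes to the odd position 1, the free ones to the even
    positions.\<close>
  have "dioph (\<lambda>e. P (e 1) (\<lambda>i. e (2 * i)))"
    using dioph_rename[OF assms, of "case_nat 1 (\<lambda>i. 2 * i)"] by simp
  then have "dioph (\<lambda>e. \<exists>h :: nat \<Rightarrow> nat. P (h 0) e)"
    by (drule_tac dioph_exs) simp
  moreover have "(\<exists>h :: nat \<Rightarrow> nat. P (h 0) e) \<longleftrightarrow> (\<exists>x. P x e)" for e
    by (auto intro: exI[of _ "\<lambda>_. x" for x])
  ultimately show ?thesis by simp
qed

text \<open>Describing functions by their graphs lets terms be substituted through existential
  quantifiers, without a syntax of terms.\<close>

definition dfun :: "((nat \<Rightarrow> nat) \<Rightarrow> nat) \<Rightarrow> bool" where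
  "dfun f \<longleftrightarrow> dioph (\<lambda>e. e 0 = f (\<lambda>i. e (Suc i)))"

lemma dioph_eq_rename:
  assumes "dfun f" shows "dioph (\<lambda>e. e k = f (\<lambda>i. e (\<rho> i)))"
  using dioph_rename[OF assms[unfolded dfun_def], of "case_nat k \<rho>"] by simp

lemma dfun_rename: "dfun f \<Longrightarrow> dfun (\<lambda>e. f (\<lambda>i. e (\<rho> i)))"
  unfolding dfun_def[of "\<lambda>e. f (\<lambda>i. e (\<rho> i))"] by (rule dioph_eq_rename)

lemma dfun_shift: "dfun f \<Longrightarrow> dfun (\<lambda>e. f (\<lambda>i. e (Suc i)))"
  by (rule dfun_rename)

lemma dioph_comp2:
  assumes "dioph (\<lambda>e. P (e 0) (e 1))" "dfun f" "dfun g"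
  shows "dioph (\<lambda>e. P (f e) (g e))"
proof -
  note eqs = assms(2,3)[THEN dioph_eq_rename]
  have "dioph (\<lambda>e. \<exists>x y. x = f e \<and> y = g e \<and> P x y)"
    by (intro dioph_ex dioph_conj eqs)
      \<comment> \<open>The innermost bound variable has index 0, so the arguments arrive in reverse
        order.\<close>
      (use dioph_rename[OF assms(1), of "\<lambda>i. 1 - i"] in simp)
  then show ?thesis by simp
qed

lemma dioph_comp3:
  assumes "dioph (\<lambda>e. P (e 0) (e 1) (e 2))" "dfun f" "dfun g" "dfun h"
  shows "dioph (\<lambda>e. P (f e) (g e) (h e))"
proof -
  note eqs = assms(2-4)[THEN dioph_eq_rename]
  have "dioph (\<lambda>e. \<exists>x y z. x = f e \<and> y = g e \<and> z = h e \<and> P x y z)"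
    by (intro dioph_ex dioph_conj eqs)
      (use dioph_rename[OF assms(1), of "\<lambda>i. 2 - i"] in \<open>simp add: numeral_2_eq_2\<close>)
  then show ?thesis by simp
qed

lemma dioph_comp4:
  assumes "dioph (\<lambda>e. P (e 0) (e 1) (e 2) (e 3))" "dfun f" "dfun g" "dfun h" "dfun k"
  shows "dioph (\<lambda>e. P (f e) (g e) (h e) (k e))"
proof -
  note eqs = assms(2-5)[THEN dioph_eq_rename]
  have "dioph (\<lambda>e. \<exists>x y z w. x = f e \<and> y = g e \<and> z = h e \<and> w = k e \<and> P x y z w)"
    by (intro dioph_ex dioph_conj eqs)
      (use dioph_rename[OF assms(1), of "\<lambda>i. 3 - i"] in \<open>simp add: numeral_3_eq_3 numeral_2_eq_2\<close>)
  then show ?thesis by simp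
qed

lemma dfun_var: "dfun (\<lambda>e. e i)"
  unfolding dfun_def
  \<comment> \<open>Equality of variables is not an atom; it is expressed by adding a hidden
    zero.\<close>
  by (rule diophI[where S = "[Const_Eq (Inr 0) 0, Plus_Eq (Inl 0) (Inr 0) (Inl (Suc i))]"]) auto

lemma dfun_const: "dfun (\<lambda>e. c)"
  unfolding dfun_def by (rule diophI[where S = "[Const_Eq (Inl 0) c]"]) auto

lemma dfun_comp1:
  assumes "dioph (\<lambda>e. e 0 = F (e 1))" "dfun f"
  shows "dfun (\<lambda>e. F (f e))"
  unfolding dfun_def
  by (rule dioph_comp2[where P = "\<lambda>x y. x = F y"]) (intro assms dfun_var dfun_shift[OF assms(2)])+

lemma dfun_comp2:
  assumes "dioph (\<lambda>e. e 0 = F (e 1) (e 2))" "dfun f" "dfun g"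
  shows "dfun (\<lambda>e. F (f e) (g e))"
  unfolding dfun_def
  by (rule dioph_comp3[where P = "\<lambda>x y z. x = F y z"])
    (intro assms dfun_var assms(2,3)[THEN dfun_shift])+

lemma dioph_eq: "dfun f \<Longrightarrow> dfun g \<Longrightarrow> dioph (\<lambda>e. f e = g e)"
  by (rule dioph_comp2[where P = "(=)"])
    (rule diophI[where S = "[Const_Eq (Inr 0) 0, Plus_Eq (Inl 0) (Inr 0) (Inl 1)]"], auto)

lemma dfun_add: "dfun f \<Longrightarrow> dfun g \<Longrightarrow> dfun (\<lambda>e. f e + g e)"
  by (rule dfun_comp2[where F = "(+)"])
    (rule diophI[where S = "[Plus_Eq (Inl 1) (Inl 2) (Inl 0)]"], auto)

lemma dfun_mult: "dfun f \<Longrightarrow> dfun g \<Longrightarrow> dfun (\<lambda>e. f e * g e)"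
  by (rule dfun_comp2[where F = "(*)"])
    (rule diophI[where S = "[Times_Eq (Inl 1) (Inl 2) (Inl 0)]"], auto)

lemma dfun_Suc: "dfun f \<Longrightarrow> dfun (\<lambda>e. Suc (f e))"
  using dfun_add[OF _ dfun_const[of 1]] by simp

named_theorems dioph_intros

lemmas [dioph_intros] = dioph_ex dioph_conj dioph_eq dfun_var dfun_const dfun_add dfun_mult dfun_Suc

lemma dioph_le [dioph_intros]: "dfun f \<Longrightarrow> dfun g \<Longrightarrow> dioph (\<lambda>e. f e \<le> g e)"
  by (rule dioph_comp2) (unfold le_iff_add, intro dioph_intros)

lemma dioph_less [dioph_intros]: "dfun f \<Longrightarrow> dfun g \<Longrightarrow> dioph (\<lambda>e. f e < g e)"
  unfolding Suc_le_eq[symmetric] by (intro dioph_intros)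

lemma dioph_dvd [dioph_intros]: "dfun f \<Longrightarrow> dfun g \<Longrightarrow> dioph (\<lambda>e. f e dvd g e)"
  by (rule dioph_comp2) (unfold dvd_def, intro dioph_intros)

lemma dioph_cong [dioph_intros]:
  "dfun f \<Longrightarrow> dfun g \<Longrightarrow> dfun h \<Longrightarrow> dioph (\<lambda>e. [f e = g e] (mod h e))"
  by (rule dioph_comp3) (unfold cong_iff_lin_nat, intro dioph_intros)

text \<open>Divisors of the form \<open>Suc\<close> exclude 0, which would otherwise call for a
  disjunction. Bases of powers have this form for the same reason.\<close>

lemma dfun_div_Suc [dioph_intros]: "dfun f \<Longrightarrow> dfun g \<Longrightarrow> dfun (\<lambda>e. f e div Suc (g e))"
proof (rule dfun_comp2[where F = "\<lambda>x y. x div Suc y"])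
  have "q = x div Suc y \<longleftrightarrow> (\<exists>r. x = q * Suc y + r \<and> r < Suc y)" for q x y
  proof
    assume "\<exists>r. x = q * Suc y + r \<and> r < Suc y"
    then show "q = x div Suc y" by (metis div_mult_self3 div_less add_0_right add.commute nat.distinct(1))
  qed (metis mod_less_divisor div_mult_mod_eq zero_less_Suc)
  then show "dioph (\<lambda>e. e 0 = e 1 div Suc (e 2))" by (simp only:) (intro dioph_intros)
qed

lemma dfun_mod_Suc [dioph_intros]: "dfun f \<Longrightarrow> dfun g \<Longrightarrow> dfun (\<lambda>e. f e mod Suc (g e))"
proof (rule dfun_comp2[where F = "\<lambda>x y. x mod Suc y"])
  have "r = x mod Suc y \<longleftrightarrow> r + Suc y * (x div Suc y) = x" for r x y
    by (metis mod_mult_div_eq add_right_cancel)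
  then show "dioph (\<lambda>e. e 0 = e 1 mod Suc (e 2))" by (simp only:) (intro dioph_intros)
qed

definition pell_rel :: "nat \<Rightarrow> nat \<Rightarrow> nat \<Rightarrow> nat \<Rightarrow> bool" where
  "pell_rel a k x y \<longleftrightarrow> 3 \<le> a \<and> 1 \<le> k \<and> int x = pell_x (int a) k \<and> int y = pell_y (int a) k"

lemma dioph_pell [dioph_intros]:
  assumes "dfun a" "dfun k" "dfun x" "dfun y"
  shows "dioph (\<lambda>e. pell_rel (a e) (k e) (x e) (y e))"
proof (rule dioph_comp4)
  have "pell_rel a k x y \<longleftrightarrow> 3 \<le> a \<and> 1 \<le> k \<and> k \<le> y \<and>
    (\<exists>u v s t b. x * x + y * y = a * a * y * y + 1 \<and> u * u + v * v = a * a * v * v + 1 \<and>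
      s * s + t * t = b * b * t * t + 1 \<and> [b = 1] (mod 4 * y) \<and> [b = a] (mod u) \<and>
      1 \<le> v \<and> y * y dvd v \<and> [s = x] (mod u) \<and> [t = k] (mod 4 * y))" for a k x y
    unfolding pell_rel_def using matiyasevich[of a k x y] by blast
  then show "dioph (\<lambda>e. pell_rel (e 0) (e 1) (e 2) (e 3))"
    by (simp only:) (intro dioph_intros)
qed fact+

text \<open>The Pell description needs a positive exponent, so it is applied to
  \<open>Suc n ^ Suc k = m * Suc n\<close>. This covers \<open>k = 0\<close> without a case
  distinction.\<close>

lemma dfun_power_Suc [dioph_intros]: "dfun f \<Longrightarrow> dfun g \<Longrightarrow> dfun (\<lambda>e. Suc (f e) ^ g e)"
proof (rule dfun_comp2[where F = "\<lambda>n k. Suc n ^ k"])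
  have "m = Suc n ^ k \<longleftrightarrow> (\<exists>a b x y t. pell_rel (n + 3) (Suc k) a b \<and> pell_rel a (Suc k) x y \<and>
    t + Suc n * Suc n + 1 = 2 * a * Suc n \<and> m * Suc n < t \<and> [x + y * Suc n = y * a + m * Suc n] (mod t))"
    for m n k
  proof -
    have "m = Suc n ^ k \<longleftrightarrow> m * Suc n = Suc n ^ Suc k" by (simp only: power_Suc2 mult_cancel2) simp
    moreover have "3 \<le> a" if "int a = pell_x (int (n + 3)) (Suc k)" for a
    proof -
      have "int (n + 3) ^ 1 \<le> int (n + 3) ^ Suc k" by (intro power_increasing) auto
      also have "\<dots> \<le> int a" unfolding that by (rule pell_x_ge_power) simp
      finally show ?thesis by simp
    qed
    ultimately show ?thesis
      using power_eq_iff_pell[of "Suc n" "Suc k" "m * Suc n"] unfolding pell_rel_def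
      by (simp add: eval_nat_numeral) blast
  qed
  then show "dioph (\<lambda>e. e 0 = Suc (e 1) ^ e 2)"
    by (simp only:) (intro dioph_intros)
qed

section \<open>Binomial coefficients and bounded quantifiers\<close>

lemma digit_sum_less:
  fixes b :: nat
  assumes "\<And>i. i < k \<Longrightarrow> d i < b"
  shows "(\<Sum>i<k. d i * b ^ i) < b ^ k"
  using assms
proof (induction k)
  case (Suc k)
  have "(\<Sum>i<k. d i * b ^ i) < b ^ k" using Suc by simp
  moreover have "Suc (d k) * b ^ k \<le> b * b ^ k" using Suc.prems[of k] by (intro mult_right_mono) auto
  ultimately show ?case by simp
qed simp

text \<open>In the expansion of \<open>(b + 1) ^ n\<close> by powers of \<open>b\<close>, the
  coefficients are at most \<open>2 ^ n\<close> and therefore proper digits.\<close>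

lemma binomial_eq_digit:
  assumes "b > 2 ^ n"
  shows "\<exists>w v. Suc b ^ n = w * b ^ Suc k + (n choose k) * b ^ k + v \<and> v < b ^ k \<and> (n choose k) < b"
proof -
  have less: "(n choose i) < b" for i
    using assms binomial_le_pow2[of n i] by linarith
  define w where "w = (\<Sum>i<n. (n choose (i + Suc k)) * b ^ i)"
  define v where "v = (\<Sum>i<k. (n choose i) * b ^ i)"
  have "Suc b ^ n = (\<Sum>i\<le>n. (n choose i) * b ^ i)"
    using binomial[of b 1 n] by simp
  also have "\<dots> = (\<Sum>i<n + Suc k. (n choose i) * b ^ i)"
    \<comment> \<open>Summing up to \<open>n + k\<close> only adds zeros and makes the split at
      \<open>Suc k\<close> valid even for \<open>k > n\<close>.\<close>
    by (intro sum.mono_neutral_left) auto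
  also have "\<dots> = (\<Sum>i<Suc k. (n choose i) * b ^ i) + (\<Sum>i=Suc k..<n + Suc k. (n choose i) * b ^ i)"
    unfolding lessThan_atLeast0 by (intro sum.atLeastLessThan_concat[symmetric]) auto
  also have "(\<Sum>i=Suc k..<n + Suc k. (n choose i) * b ^ i) = w * b ^ Suc k"
    using sum.shift_bounds_nat_ivl[of "\<lambda>i. (n choose i) * b ^ i" 0 "Suc k" n]
    unfolding w_def sum_distrib_right lessThan_atLeast0 by (simp add: power_add mult_ac)
  finally have "Suc b ^ n = w * b ^ Suc k + (n choose k) * b ^ k + v" by (simp add: v_def)
  moreover have "v < b ^ k" unfolding v_def by (rule digit_sum_less) (rule less)
  ultimately show ?thesis using less by blast
qed

lemma digit_unique:
  fixes b :: nat
  assumes "N = w * b ^ Suc k + m * b ^ k + v" "v < b ^ k" "m < b"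
  shows "m = N div b ^ k mod b"
proof -
  have "N = v + b ^ k * (m + b * w)" using assms(1) by (simp add: algebra_simps)
  moreover have "b ^ k \<noteq> 0" using assms(2) by linarith
  ultimately have "N div b ^ k = m + b * w" using assms(2) by (metis div_mult_self2 div_less add_0_right)
  then show ?thesis using assms(3) by simp
qed

lemma dfun_binomial [dioph_intros]: "dfun f \<Longrightarrow> dfun g \<Longrightarrow> dfun (\<lambda>e. f e choose g e)"
proof (rule dfun_comp2[where F = "(choose)"])
  have "m = (n choose k) \<longleftrightarrow> (\<exists>c b w v. c = Suc 1 ^ n \<and> b = Suc c \<and>
      Suc b ^ n = w * Suc c ^ Suc k + m * Suc c ^ k + v \<and> v < Suc c ^ k \<and> m < b)" (is "_ \<longleftrightarrow> ?R")
    for m n k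
  proof
    assume "m = (n choose k)"
    then show ?R using binomial_eq_digit[of n "Suc (2 ^ n)" k] by (auto simp: numeral_2_eq_2)
  next
    define b :: nat where "b = Suc (Suc 1 ^ n)"
    assume ?R
    then obtain w v where m: "Suc b ^ n = w * b ^ Suc k + m * b ^ k + v" "v < b ^ k" "m < b"
      unfolding b_def by metis
    have "b > 2 ^ n" by (simp add: b_def numeral_2_eq_2)
    then obtain w' v' where c: "Suc b ^ n = w' * b ^ Suc k + (n choose k) * b ^ k + v'" "v' < b ^ k"
      "(n choose k) < b" using binomial_eq_digit by blast
    show "m = (n choose k)" using digit_unique[OF m] digit_unique[OF c] by simp
  qed
  then show "dioph (\<lambda>e. e 0 = e 1 choose e 2)"
    by (simp only:) (intro dioph_intros)
qed

text \<open>Bernoulli's inequality with denominators cleared: each factor \<open>r - i\<close> is at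
  least \<open>r * (1 - q / r)\<close>, and \<open>(1 - q / r) ^ j\<close> is at least
  \<open>1 - j * q / r\<close>.\<close>

lemma binomial_times_fact_ge:
  fixes r q :: nat
  assumes "q \<le> r" "j \<le> q"
  shows "int r ^ j * (int r - int j * int q) \<le> (\<Prod>i<j. int (r - i)) * int r"
  using assms(2)
proof (induction j)
  case (Suc j)
  have nn: "0 \<le> int r - int j" using Suc.prems assms(1) by simp
  have "int r ^ Suc j * (int r - int (Suc j) * int q) = int r ^ j * (int r * (int r - int (Suc j) * int q))"
    by simp
  also have "\<dots> \<le> int r ^ j * ((int r - int j * int q) * (int r - int j))"
  proof (intro mult_left_mono)
    have "int r * int j \<le> int r * int q" using Suc.prems by (intro mult_left_mono) auto
    then have "int r * int j \<le> int r * int q + int j * (int j * int q)"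
      by (rule add_increasing2[rotated]) simp
    then show "int r * (int r - int (Suc j) * int q) \<le> (int r - int j * int q) * (int r - int j)"
      by (simp add: algebra_simps)
  qed simp
  also have "\<dots> = (int r ^ j * (int r - int j * int q)) * (int r - int j)" by simp
  also have "\<dots> \<le> ((\<Prod>i<j. int (r - i)) * int r) * (int r - int j)"
    using Suc nn by (intro mult_right_mono) auto
  also have "\<dots> = (\<Prod>i<Suc j. int (r - i)) * int r"
    using Suc.prems assms(1) by (simp add: of_nat_diff)
  finally show ?case .
qed simp

lemma fact_times_binomial: "fact k * (n choose k) = (\<Prod>i<k. n - i)"
proof (induction k)
  case (Suc k)
  have "Suc k * (n choose Suc k) = (n - k) * (n choose k)"
    unfolding binomial_absorption binomial_absorb_comp ..
  then have "fact (Suc k) * (n choose Suc k) = (n - k) * (fact k * (n choose k))"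
    by (metis fact_Suc of_nat_id mult.assoc mult.commute)
  then show ?case using Suc by simp
qed simp

text \<open>The quotient \<open>r ^ q / (r choose q)\<close> is \<open>fact q\<close> times a factor
  that tends to 1 as \<open>r\<close> grows. By the preceding estimate its integer part is
  \<open>fact q\<close> as soon as \<open>r > (fact q + 1) * (q * q)\<close>, and the exponent
  \<open>q + 2\<close> is large enough for this.\<close>

lemma fact_times_binomial_bounds:
  assumes r: "r = Suc q ^ (q + 2)"
  shows "(r choose q) * fact q \<le> r ^ q" "r ^ q < (r choose q) * fact q + (r choose q)"
proof -
  show "(r choose q) * fact q \<le> r ^ q" by (rule binomial_fact_pow)
  have qr: "q \<le> r"
  proof -
    have "Suc q ^ 1 \<le> r" unfolding r by (rule power_increasing) auto
    then show ?thesis by simp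
  qed
  have bound: "(fact q + 1) * (q * q) < r"
  proof (cases "q = 0")
    case False
    have "fact q \<le> q ^ q" using fact_le_power[where 'a = nat, of q] by simp
    moreover have "q ^ q < Suc q ^ q" using False by (intro power_strict_mono) auto
    ultimately have "fact q + 1 \<le> Suc q ^ q" by simp
    then have "(fact q + 1) * (q * q) \<le> Suc q ^ q * (q * q)" by (rule mult_right_mono) simp
    also have "\<dots> < Suc q ^ q * (Suc q * Suc q)" by (intro mult_strict_left_mono mult_strict_mono) auto
    finally show ?thesis unfolding r power_add power2_eq_square .
  qed (simp add: r)
  have P: "(\<Prod>i<q. int (r - i)) = fact q * int (r choose q)"
    using arg_cong[OF fact_times_binomial[of q r], of int]
    by (simp only: of_nat_prod of_nat_mult of_nat_fact)
  have r0: "0 < int r" using bound by linarith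
  have "fact q * int r ^ q * int (q * q) + int r ^ q * int (q * q) = int r ^ q * int ((fact q + 1) * (q * q))"
    by (simp add: algebra_simps)
  also have "\<dots> < int r ^ q * int r"
    using bound r0 by (intro mult_strict_left_mono) (simp_all only: of_nat_less_iff zero_less_power)
  finally have "fact q * int r ^ q * int (q * q) < int r ^ q * (int r - int q * int q)"
    by (simp add: algebra_simps)
  also have le: "int r ^ q * (int r - int q * int q) \<le> fact q * int (r choose q) * int r"
    using binomial_times_fact_ge[OF qr order_refl] unfolding P .
  finally have lt: "fact q * int r ^ q * int (q * q) < fact q * int (r choose q) * int r" .
  have "int r * (int r ^ q - fact q * int (r choose q)) \<le> int (q * q) * int r ^ q"
    using le by (simp add: algebra_simps)
  then have "fact q * (int r * (int r ^ q - fact q * int (r choose q))) \<le> fact q * (int (q * q) * int r ^ q)"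
    by (intro mult_left_mono) auto
  then have "(fact q * int r) * (int r ^ q - fact q * int (r choose q)) < (fact q * int r) * int (r choose q)"
    using lt by (simp add: mult_ac)
  then have "int r ^ q - fact q * int (r choose q) < int (r choose q)"
    by (simp add: mult_less_cancel_left r0)
  then have "int (r ^ q) < int ((r choose q) * fact q + (r choose q))" by (simp add: mult.commute)
  then show "r ^ q < (r choose q) * fact q + (r choose q)" by (simp only: of_nat_less_iff)
qed

lemma dfun_fact [dioph_intros]: "dfun f \<Longrightarrow> dfun (\<lambda>e. fact (f e))"
proof (rule dfun_comp1[where F = fact])
  have "m = fact q \<longleftrightarrow> (\<exists>r c. Suc r = Suc q ^ (q + 2) \<and> c = (Suc r choose q) \<and>
      c * m \<le> Suc r ^ q \<and> Suc r ^ q < c * m + c)" (is "_ \<longleftrightarrow> ?R") for m q :: nat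
  proof
    assume "m = fact q"
    obtain r where r: "Suc r = Suc q ^ (q + 2)" by (metis not0_implies_Suc power_not_zero nat.distinct(1))
    show ?R using fact_times_binomial_bounds[OF r] \<open>m = fact q\<close> r by blast
  next
    assume ?R
    then obtain r c where r: "r = Suc q ^ (q + 2)" "c = (r choose q)" and
      m: "c * m \<le> r ^ q" "r ^ q < c * m + c" by blast
    note b = fact_times_binomial_bounds[OF r(1), folded r(2)]
    have "c * m < c * Suc (fact q)" using m b by simp
    moreover have "c * fact q < c * Suc m" using m b by simp
    ultimately show "m = fact q" by (simp only: mult_less_cancel1) linarith
  qed
  then show "dioph (\<lambda>e. e 0 = fact (e 1))"
    by (simp only:) (intro dioph_intros)
qed

section \<open>Elimination of bounded quantifiers\<close>

lemma dioph_ball: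
  assumes "\<And>x. x \<in> set L \<Longrightarrow> dioph (P x)"
  shows "dioph (\<lambda>e. \<forall>x\<in>set L. P x e)"
  using assms
proof (induction L)
  case Nil
  have "dioph (\<lambda>e. e 0 = e 0)" by (intro dioph_intros)
  then show ?case by simp
next
  case (Cons x L)
  then show ?case by (simp add: dioph_conj)
qed

lemma dioph_ex_fun:
  assumes "dioph (\<lambda>e. P (\<lambda>i. e (2 * i + 1)) (\<lambda>i. e (2 * i)))"
  shows "dioph (\<lambda>e. \<exists>h. P h e)"
  using dioph_exs[OF assms] by simp

text \<open>Moduli for the Chinese remainder theorem. For \<open>T = (fact Q)\<^sup>2\<close> the division is exact, the moduli
  with \<open>k < y \<le> Q\<close> are pairwise coprime without prime factors \<open>\<le> Q\<close>, and their product is the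
  binomial coefficient \<open>T + y choose y\<close>, which makes it Diophantine. Moreover \<open>- Suc T\<close> is congruent
  to \<open>k\<close> for the \<open>k\<close>-th modulus.\<close>

definition crt_mod :: "nat \<Rightarrow> nat \<Rightarrow> nat" where
  "crt_mod T k = Suc (T div Suc k)"

lemma Suc_mult_crt_mod: "Suc k dvd T \<Longrightarrow> Suc k * crt_mod T k = T + Suc k"
  unfolding crt_mod_def by (simp only: mult_Suc_right dvd_mult_div_cancel add.commute)

lemma crt_mod_dvd: "Suc k dvd T \<Longrightarrow> crt_mod T k dvd T + Suc k"
  by (metis Suc_mult_crt_mod dvd_triv_right)

lemma Suc_dvd_fact: "k < Q \<Longrightarrow> Suc k dvd fact Q"
  by (intro dvd_fact) auto

context
  fixes Q T y :: nat
  assumes T: "T = fact Q * fact Q" and yQ: "y \<le> Q"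
begin

lemma Suc_dvd_T: "k < y \<Longrightarrow> Suc k dvd T"
  unfolding T using yQ by (intro dvd_mult Suc_dvd_fact) simp

lemma fact_dvd_T_div: "k < y \<Longrightarrow> fact Q dvd T div Suc k"
  using Suc_dvd_fact[of k Q] yQ unfolding T by (simp add: div_mult_swap[symmetric])

text \<open>Since \<open>T\<close> is the square of \<open>fact Q\<close>, the quotient
  \<open>T div Suc k\<close> is still a multiple of \<open>fact Q\<close>. Hence the modulus is 1
  modulo every prime up to \<open>Q\<close>.\<close>

lemma crt_mod_prime_gt:
  assumes "k < y" "prime p" "p dvd crt_mod T k" shows "p > Q"
proof (rule ccontr)
  assume "\<not> p > Q"
  then have "p dvd fact Q" using assms(2) by (simp add: prime_dvd_fact_iff)
  then have "p dvd T div Suc k" using fact_dvd_T_div[OF assms(1)] by (rule dvd_trans)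
  then have "p dvd 1" using assms(3) unfolding crt_mod_def by (metis dvd_add_right_iff Suc_eq_plus1)
  then show False using assms(2) by (simp add: not_prime_unit)
qed

lemma crt_mod_gt: "k < y \<Longrightarrow> crt_mod T k > Q"
proof -
  assume "k < y"
  have "T > 0" by (simp add: T)
  have "T div Suc k > 0"
    using Suc_dvd_T[OF \<open>k < y\<close>] \<open>T > 0\<close> by (simp add: div_greater_zero_iff dvd_imp_le)
  then have "fact Q \<le> T div Suc k" using fact_dvd_T_div[OF \<open>k < y\<close>] by (simp add: dvd_imp_le)
  then show ?thesis using fact_ge_self[of Q] unfolding crt_mod_def by linarith
qed

text \<open>A common prime factor would divide the difference of \<open>T + Suc k\<close> and
  \<open>T + Suc l\<close>, which is too small for a prime above \<open>Q\<close>.\<close>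

lemma crt_mod_coprime:
  assumes "k < y" "l < y" "k \<noteq> l" shows "coprime (crt_mod T k) (crt_mod T l)"
proof (rule ccontr)
  assume "\<not> ?thesis"
  then have "gcd (crt_mod T k) (crt_mod T l) \<noteq> 1" by (simp only: coprime_iff_gcd_eq_1 simp_thms)
  then obtain p where "prime p" "p dvd gcd (crt_mod T k) (crt_mod T l)" using prime_factor_nat by blast
  then have p: "prime p" "p dvd crt_mod T k" "p dvd crt_mod T l" by simp_all
  have "p dvd T + Suc k" "p dvd T + Suc l"
    using p(2,3) crt_mod_dvd[OF Suc_dvd_T] assms(1,2) by (auto elim: dvd_trans)
  then have "[T + Suc k = T + Suc l] (mod p)" by (simp only: cong_def dvd_eq_mod_eq_0)
  then have "[Suc k = Suc l] (mod p)" by (simp only: cong_add_lcancel_nat)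
  moreover have "Suc k < p" "Suc l < p" using crt_mod_prime_gt[OF assms(1) p(1,2)] assms yQ by auto
  ultimately show False using assms(3) cong_less_modulus_unique_nat by blast
qed

text \<open>The \<open>k\<close>-th modulus is \<open>(T + Suc k) / Suc k\<close>, so the
  denominators multiply to \<open>fact n\<close>.\<close>

lemma prod_crt_mod: "n \<le> y \<Longrightarrow> (\<Prod>k<n. crt_mod T k) = (T + n choose n)"
proof (induction n)
  case (Suc n)
  have "Suc n dvd T" using Suc_dvd_T[of n] Suc.prems by simp
  then have e: "Suc n * crt_mod T n = T + Suc n" by (rule Suc_mult_crt_mod)
  have "Suc n * (T + Suc n choose Suc n) = Suc (T + n) * (T + n choose n)"
    using Suc_times_binomial_eq[of "T + n" n] by simp
  also have "\<dots> = Suc n * (crt_mod T n * (T + n choose n))" using e by (metis add_Suc_right mult.assoc)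
  finally have "(T + Suc n choose Suc n) = crt_mod T n * (T + n choose n)"
    by (metis mult_cancel1 nat.distinct(1))
  then show ?case using Suc by simp
qed simp

lemma crt_mod_cong_prod:
  assumes "\<And>k. k < y \<Longrightarrow> [a = b] (mod crt_mod T k)"
  shows "[a = b] (mod (T + y choose y))"
proof -
  have "[a = b] (mod (\<Prod>k<y. crt_mod T k))"
    by (rule coprime_cong_prod_nat) (use assms crt_mod_coprime in auto)
  then show ?thesis by (simp add: prod_crt_mod)
qed

lemma crt_exists: "\<exists>c. \<forall>k<y. [c = w k] (mod crt_mod T k)"
  using chinese_remainder_nat[of "{..<y}" "crt_mod T" w] crt_mod_coprime by auto

end

primrec sat_mod :: "nat \<Rightarrow> ('v \<Rightarrow> nat) \<Rightarrow> 'v atom \<Rightarrow> bool" where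
  "sat_mod M e (Const_Eq x c) \<longleftrightarrow> [e x = c] (mod M)"
| "sat_mod M e (Plus_Eq x y z) \<longleftrightarrow> [e x + e y = e z] (mod M)"
| "sat_mod M e (Times_Eq x y z) \<longleftrightarrow> [e x * e y = e z] (mod M)"

primrec atom_const :: "'v atom \<Rightarrow> nat" where
  "atom_const (Const_Eq x c) = c"
| "atom_const (Plus_Eq x y z) = 0"
| "atom_const (Times_Eq x y z) = 0"

lemma cong_equation_cong:
  fixes a b c d M :: nat
  assumes "[a = c] (mod M)" "[b = d] (mod M)"
  shows "[a = b] (mod M) \<longleftrightarrow> [c = d] (mod M)"
  using assms by (auto simp: cong_def)

lemma sat_mod_cong:
  assumes "\<And>v. v \<in> set_atom A \<Longrightarrow> [e v = e' v] (mod M)"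
  shows "sat_mod M e A \<longleftrightarrow> sat_mod M e' A"
  using assms by (cases A) (auto intro!: cong_equation_cong cong_add cong_mult)

lemma sat_mod_dvd: "sat_mod M e A \<Longrightarrow> m dvd M \<Longrightarrow> sat_mod m e A"
  by (cases A) (auto intro: cong_dvd_modulus_nat)

lemma sat_imp_sat_mod: "sat e A \<Longrightarrow> sat_mod M e A"
  by (cases A) auto

text \<open>The bound dominates either side of an atom: a product by \<open>u * u\<close>, a sum by
  \<open>2 * u\<close>, a constant by \<open>atom_const A\<close>.\<close>

lemma sat_mod_imp_sat:
  assumes "sat_mod M e A" "\<And>v. v \<in> set_atom A \<Longrightarrow> e v \<le> u" "u * u + 2 * u + atom_const A < M"
  shows "sat e A"
proof -
  have le: "x * y \<le> u * u" if "x \<le> u" "y \<le> u" for x y using that by (rule mult_le_mono)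
  show ?thesis
  proof (cases A)
    case (Const_Eq x c)
    then have "e x < M" "c < M" using assms(2)[of x] assms(3) by simp_all
    then show ?thesis using assms(1) Const_Eq cong_less_modulus_unique_nat by auto
  next
    case (Plus_Eq x y z)
    then have "e x + e y < M" "e z < M"
      using assms(2)[of x] assms(2)[of y] assms(2)[of z] assms(3) by simp_all
    then show ?thesis using assms(1) Plus_Eq cong_less_modulus_unique_nat by auto
  next
    case (Times_Eq x y z)
    then have "e x * e y < M" "e z < M"
      using le[of "e x" "e y"] assms(2)[of x] assms(2)[of y] assms(2)[of z] assms(3) by simp_all
    then show ?thesis using assms(1) Times_Eq cong_less_modulus_unique_nat by auto
  qed
qed

text \<open>The prime divides the falling product \<open>a * (a - 1) * ... * (a - u)\<close> and
  hence one of its factors.\<close>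

lemma prime_dvd_binomial_imp:
  fixes a p u :: nat
  assumes "prime p" "p dvd (a choose Suc u)"
  shows "\<exists>w\<le>u. [a = w] (mod p)"
proof -
  have "p dvd fact (Suc u) * (a choose Suc u)" using assms(2) by (rule dvd_mult)
  then have "p dvd (\<Prod>i<Suc u. a - i)" by (simp only: fact_times_binomial)
  then obtain i where i: "i < Suc u" "p dvd a - i"
    unfolding prime_dvd_prod_iff[OF finite_lessThan assms(1)] by blast
  show ?thesis
  proof (cases "i \<le> a")
    case True
    then have "[a = i] (mod p)" using i(2) by (simp add: cong_altdef_nat)
    then show ?thesis using i(1) by (intro exI[of _ i]) simp
  \<comment> \<open>For \<open>a < i\<close> the subtraction is truncated; then \<open>a\<close>
    itself is at most \<open>u\<close>.\<close>
  qed (use i(1) in \<open>auto intro!: exI[of _ a]\<close>)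
qed

text \<open>For \<open>w \<le> a\<close>, \<open>a - w\<close> is a factor of the falling product,
  and coprimality cancels the factorial. Otherwise the binomial coefficient is 0.\<close>

lemma dvd_binomial_if_cong:
  fixes a m u :: nat
  assumes "[a = w] (mod m)" "w \<le> u" "coprime m (fact (Suc u))"
  shows "m dvd (a choose Suc u)"
proof (cases "w \<le> a")
  case True
  then have "m dvd a - w" using assms(1) by (simp add: cong_altdef_nat)
  also have "a - w dvd (\<Prod>i<Suc u. a - i)" using assms(2) by (intro dvd_prodI) auto
  finally have "m dvd fact (Suc u) * (a choose Suc u)" by (simp only: fact_times_binomial)
  then show ?thesis using assms(3) coprime_dvd_mult_right_iff by blast
next
  case False
  then show ?thesis using assms(2) by (simp add: binomial_eq_0)
qed

text \<open>The witnesses for all \<open>k < y\<close> are coded into one number \<open>a j\<close> per hidden variable by the Chinese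
  remainder theorem. That the residues of \<open>a j\<close> are at most \<open>u\<close> is expressed by the divisibility of
  a binomial coefficient by \<open>M\<close>; since \<open>Q\<close> bounds both sides of every atom then, congruences modulo a
  prime factor of a modulus are equations.\<close>

lemma bounded_all_iff:
  fixes S :: "(nat + nat) atom list" and e :: "nat \<Rightarrow> nat"
  defines "V \<equiv> \<Union>A\<in>set S. set_atom A" and "K \<equiv> \<Sum>A\<leftarrow>S. atom_const A"
  shows "(\<forall>k<y. \<exists>h. \<forall>A\<in>set S. sat (case_sum (case_nat k e) h) A) \<longleftrightarrow>
    (\<exists>u Q M c a. y \<le> u \<and> u * u + 2 * u + K \<le> Q \<and> M = (fact Q * fact Q + y choose y) \<and>
      M dvd c + Suc (fact Q * fact Q) \<and>
      (\<forall>v\<in>V. case v of Inl i \<Rightarrow> (case i of 0 \<Rightarrow> True | Suc i \<Rightarrow> e i \<le> u)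
        | Inr j \<Rightarrow> M dvd (a j choose Suc u)) \<and>
      (\<forall>A\<in>set S. sat_mod M (case_sum (case_nat c e) a) A))" (is "?L \<longleftrightarrow> ?R")
proof
  assume ?R
  then obtain u Q M c a where yu: "y \<le> u" and Q: "u * u + 2 * u + K \<le> Q" and
    M: "M = (fact Q * fact Q + y choose y)" and c: "M dvd c + Suc (fact Q * fact Q)" and
    V: "\<forall>v\<in>V. case v of Inl i \<Rightarrow> (case i of 0 \<Rightarrow> True | Suc i \<Rightarrow> e i \<le> u)
        | Inr j \<Rightarrow> M dvd (a j choose Suc u)" and
    S: "\<And>A. A \<in> set S \<Longrightarrow> sat_mod M (case_sum (case_nat c e) a) A" by blast
  define T :: nat where "T = fact Q * fact Q"
  have yQ: "y \<le> Q" using yu Q by linarith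
  show ?L
  proof (intro allI impI)
    fix k assume k: "k < y"
    have "crt_mod T k \<noteq> 1" using crt_mod_gt[OF T_def yQ k] k yQ by linarith
    \<comment> \<open>Primality is what turns divisibility of a binomial coefficient into a small
      residue; one prime factor for each \<open>k\<close> suffices.\<close>
    then obtain p where p: "prime p" "p dvd crt_mod T k" using prime_factor_nat by blast
    have pQ: "p > Q" using crt_mod_prime_gt[OF T_def yQ k p] .
    have "crt_mod T k dvd (\<Prod>k<y. crt_mod T k)" using k by (intro dvd_prodI) auto
    also have "\<dots> = M" unfolding M T_def[symmetric] by (rule prod_crt_mod[OF T_def yQ order_refl])
    finally have pM: "p dvd M" using p(2) dvd_trans by blast
    have "p dvd T + Suc k" using p(2) crt_mod_dvd[OF Suc_dvd_T[OF T_def yQ k]] dvd_trans by blast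
    moreover have "p dvd c + Suc T" using pM c unfolding T_def by (rule dvd_trans)
    ultimately have "[c + Suc T = k + Suc T] (mod p)"
      by (simp add: cong_def dvd_eq_mod_eq_0 add.commute)
    then have ck: "[c = k] (mod p)" by (simp only: cong_add_rcancel_nat)
    have "\<exists>w\<le>u. Inr j \<in> V \<longrightarrow> [a j = w] (mod p)" for j
    proof (cases "Inr j \<in> V")
      case True
      then have "M dvd (a j choose Suc u)" using V by fastforce
      then have "p dvd (a j choose Suc u)" by (rule dvd_trans[OF pM])
      then show ?thesis using prime_dvd_binomial_imp[OF p(1)] by blast
    qed auto
    then obtain h where h: "\<And>j. h j \<le> u" "\<And>j. Inr j \<in> V \<Longrightarrow> [a j = h j] (mod p)" by metis
    have "sat (case_sum (case_nat k e) h) A" if A: "A \<in> set S" for A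
    proof (rule sat_mod_imp_sat)
      have "[case_sum (case_nat c e) a v = case_sum (case_nat k e) h v] (mod p)" if "v \<in> set_atom A" for v
      proof -
        have "v \<in> V" using that A unfolding V_def by blast
        then show ?thesis using ck h(2) by (auto split: sum.split nat.split)
      qed
      then show "sat_mod p (case_sum (case_nat k e) h) A"
        using sat_mod_cong[of A] sat_mod_dvd[OF S[OF A] pM] by blast
      show "case_sum (case_nat k e) h v \<le> u" if "v \<in> set_atom A" for v
      proof -
        have "v \<in> V" using that A unfolding V_def by blast
        then show ?thesis using V h(1) k yu by (fastforce split: sum.splits nat.splits)
      qed
      have "atom_const A \<le> K" unfolding K_def using A by (simp add: member_le_sum_list)
      then show "u * u + 2 * u + atom_const A < p" using Q pQ by linarith
    qed
    then show "\<exists>h. \<forall>A\<in>set S. sat (case_sum (case_nat k e) h) A" by blast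
  qed
next
  assume ?L
  then obtain h where h: "\<And>k A. k < y \<Longrightarrow> A \<in> set S \<Longrightarrow> sat (case_sum (case_nat k e) (h k)) A"
    by metis
  have finV: "finite V" unfolding V_def by (simp add: atom.set_finite)
  \<comment> \<open>All values that \<open>u\<close> has to bound. The last image keeps the free
    variables bounded even if \<open>y = 0\<close>.\<close>
  define W where "W = insert y ((\<lambda>(k, v). case_sum (case_nat k e) (h k) v) ` ({..<y} \<times> V)
    \<union> (\<lambda>v. case_sum (case_nat 0 e) (\<lambda>_. 0) v) ` V)"
  define u where "u = Max W"
  have finW: "finite W" unfolding W_def using finV by simp
  have le: "w \<le> u" if "w \<in> W" for w unfolding u_def using finW that by (rule Max_ge)
  define Q where "Q = u * u + 2 * u + K"
  define T :: nat where "T = fact Q * fact Q"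
  define M where "M = (T + y choose y)"
  have yu: "y \<le> u" by (rule le) (simp add: W_def)
  have yQ: "y \<le> Q" using yu unfolding Q_def by linarith
  have M: "M = (\<Prod>k<y. crt_mod T k)" unfolding M_def by (rule prod_crt_mod[OF T_def yQ order_refl, symmetric])
  obtain c where c: "\<And>k. k < y \<Longrightarrow> [c = k] (mod crt_mod T k)"
    using crt_exists[OF T_def yQ, of "\<lambda>k. k"] by blast
  have "\<forall>j. \<exists>a. \<forall>k<y. [a = h k j] (mod crt_mod T k)"
    by (intro allI crt_exists[OF T_def yQ])
  then obtain a where a: "\<And>j k. k < y \<Longrightarrow> [a j = h k j] (mod crt_mod T k)" by metis
  have prodI: "M dvd x" if "\<And>k. k < y \<Longrightarrow> crt_mod T k dvd x" for x
    using crt_mod_cong_prod[OF T_def yQ, of x 0] that unfolding M_def by (simp add: cong_0_iff)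
  have cM: "M dvd c + Suc T"
  proof (rule prodI)
    fix k assume k: "k < y"
    have "[c + Suc T = k + Suc T] (mod crt_mod T k)" using c[OF k] by (rule cong_add) simp
    moreover have "crt_mod T k dvd k + Suc T"
      using crt_mod_dvd[OF Suc_dvd_T[OF T_def yQ k]] by (simp add: add.commute)
    ultimately show "crt_mod T k dvd c + Suc T" by (simp add: cong_dvd_iff)
  qed
  have VM: "M dvd (a j choose Suc u)" if j: "Inr j \<in> V" for j
  proof (rule prodI)
    fix k assume k: "k < y"
    have "h k j \<le> u"
    proof (rule le)
      have "h k j = (\<lambda>(k, v). case_sum (case_nat k e) (h k) v) (k, Inr j)" by simp
      then show "h k j \<in> W" unfolding W_def using j k by blast
    qed
    moreover have "coprime (crt_mod T k) (fact (Suc u))"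
    proof (rule ccontr)
      assume "\<not> ?thesis"
      then have "gcd (crt_mod T k) (fact (Suc u)) \<noteq> 1" by (simp only: coprime_iff_gcd_eq_1 simp_thms)
      then obtain p where "prime p" "p dvd gcd (crt_mod T k) (fact (Suc u))" using prime_factor_nat by blast
      then have p: "prime p" "p dvd crt_mod T k" "p \<le> Suc u" by (simp_all add: prime_dvd_fact_iff del: fact_Suc)
      have "Q < Suc u" using crt_mod_prime_gt[OF T_def yQ k p(1,2)] p(3) by linarith
      moreover have "u \<ge> 1" using yu k by linarith
      ultimately show False unfolding Q_def by linarith
    qed
    ultimately show "crt_mod T k dvd (a j choose Suc u)" using a[OF k] by (intro dvd_binomial_if_cong)
  qed
  have SM: "sat_mod M (case_sum (case_nat c e) a) A" if A: "A \<in> set S" for A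
  proof -
    have "sat_mod (crt_mod T k) (case_sum (case_nat c e) a) A" if k: "k < y" for k
    proof -
      have "[case_sum (case_nat c e) a v = case_sum (case_nat k e) (h k) v] (mod crt_mod T k)" for v
        using a[OF k] c[OF k] by (auto split: sum.split nat.split)
      then show ?thesis using sat_imp_sat_mod[OF h[OF k A]] by (subst sat_mod_cong)
    qed
    then show ?thesis
      by (cases A) (auto intro!: crt_mod_cong_prod[OF T_def yQ, folded M_def])
  qed
  have VE: "e i \<le> u" if i: "Inl (Suc i) \<in> V" for i
  proof (rule le)
    have "e i = (\<lambda>v. case_sum (case_nat 0 e) (\<lambda>_. 0) v) (Inl (Suc i))" by simp
    then show "e i \<in> W" unfolding W_def using i by blast
  qed
  show ?R
  proof (intro exI conjI ballI)
    show "y \<le> u" "u * u + 2 * u + K \<le> Q" "M = (fact Q * fact Q + y choose y)"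
      using yu by (simp_all add: Q_def M_def T_def)
    show "M dvd c + Suc (fact Q * fact Q)" using cM unfolding T_def .
    show "case v of Inl i \<Rightarrow> (case i of 0 \<Rightarrow> True | Suc i \<Rightarrow> e i \<le> u)
        | Inr j \<Rightarrow> M dvd (a j choose Suc u)" if "v \<in> V" for v
      using that VM VE by (auto split: sum.split nat.split)
    show "sat_mod M (case_sum (case_nat c e) a) A" if "A \<in> set S" for A
      using SM[OF that] .
  qed
qed

text \<open>The atoms behind \<open>P\<close> form a fixed list, so the conditions on atoms and
  variables are finite conjunctions. Only the codes \<open>a j\<close> need a quantifier over
  sequences.\<close>

lemma dioph_bounded_all [dioph_intros]:
  assumes "dioph (\<lambda>e. P (e 0) (\<lambda>i. e (Suc i)))" "dfun f"
  shows "dioph (\<lambda>e. \<forall>k<f e. P k e)"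
proof -
  obtain S :: "(nat + nat) atom list"
    where S: "\<And>e. P (e 0) (\<lambda>i. e (Suc i)) \<longleftrightarrow> (\<exists>h. \<forall>A\<in>set S. sat (case_sum e h) A)"
    using assms(1) unfolding dioph_def by blast
  have P: "P k e \<longleftrightarrow> (\<exists>h. \<forall>A\<in>set S. sat (case_sum (case_nat k e) h) A)" for k e
    using S[of "case_nat k e"] by simp
  obtain VL where VL: "set VL = (\<Union>A\<in>set S. set_atom A)"
    using finite_list[of "\<Union>A\<in>set S. set_atom A"] by (auto simp: atom.set_finite)
  have v: "dfun (\<lambda>e. case_sum (case_nat (e c) (\<lambda>i. e (\<rho> i))) (\<lambda>j. e (\<tau> j)) v)"
    for c \<rho> \<tau> and v :: "nat + nat"
  proof (cases v)
    case (Inl i)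
    then show ?thesis by (cases i) (auto intro: dfun_var)
  qed (auto intro: dfun_var)
  have A: "dioph (\<lambda>e. sat_mod (e m) (case_sum (case_nat (e c) (\<lambda>i. e (\<rho> i))) (\<lambda>j. e (\<tau> j))) A)"
    for m c \<rho> \<tau> and A :: "(nat + nat) atom"
    by (cases A) (simp_all only: sat_mod.simps, (intro dioph_intros v)+)
  have V: "dioph (\<lambda>e. case v of Inl i \<Rightarrow> (case i of 0 \<Rightarrow> True | Suc i \<Rightarrow> e (\<rho> i) \<le> e u)
        | Inr j \<Rightarrow> e m dvd (e (\<tau> j) choose Suc (e u)))" for v u m \<rho> \<tau>
  proof (cases v)
    case (Inl i)
    then show ?thesis using dioph_eq[OF dfun_const dfun_const, of 0 0]
      by (cases i) (auto intro!: dioph_intros)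
  qed (auto intro!: dioph_intros)
  show ?thesis
    unfolding P bounded_all_iff VL[symmetric]
    by (intro dioph_intros dioph_ex_fun dioph_ball A V dfun_rename[OF assms(2)])
qed

section \<open>Partial recursive functions\<close>

text \<open>Goedel's beta function with the modulus \<open>crt_mod T l\<close>.\<close>

definition beta :: "nat \<Rightarrow> nat \<Rightarrow> nat \<Rightarrow> nat" where
  "beta c T l = c mod Suc (T div Suc l)"

lemma dfun_beta [dioph_intros]:
  "dfun f \<Longrightarrow> dfun g \<Longrightarrow> dfun h \<Longrightarrow> dfun (\<lambda>e. beta (f e) (g e) (h e))"
  unfolding beta_def by (intro dioph_intros)

lemma beta_exists: "\<exists>c T. \<forall>l<n. beta c T l = w l"
proof -
  \<comment> \<open>Large enough for \<open>n\<close> moduli and for every \<open>w l\<close> to be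
    smaller than its modulus.\<close>
  define Q where "Q = n + (\<Sum>l<n. w l)"
  define T :: nat where "T = fact Q * fact Q"
  have nQ: "n \<le> Q" by (simp add: Q_def)
  obtain c where c: "\<And>l. l < n \<Longrightarrow> [c = w l] (mod crt_mod T l)"
    using crt_exists[OF T_def nQ] by blast
  have "beta c T l = w l" if l: "l < n" for l
  proof -
    have "w l \<le> (\<Sum>l<n. w l)" using l by (intro member_le_sum) auto
    then have "w l < crt_mod T l" using crt_mod_gt[OF T_def nQ l] unfolding Q_def by linarith
    then show ?thesis using c[OF l] unfolding beta_def cong_def crt_mod_def by simp
  qed
  then show ?thesis by blast
qed

lemma dioph_False: "dioph (\<lambda>e. False)"
  using dioph_eq[OF dfun_const dfun_const, of 0 1] by simp

lemma primrec_eq_Some_iff: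
  "rec_nat F (\<lambda>l y. Option.bind y (G l)) k = Some y \<longleftrightarrow>
    (\<exists>w. F = Some (w 0) \<and> (\<forall>l<k. G l (w l) = Some (w (Suc l))) \<and> w k = y)"
proof (induction k arbitrary: y)
  case 0
  show ?case by (auto intro: exI[of _ "\<lambda>_. y"])
next
  case (Suc k)
  show ?case (is "?L \<longleftrightarrow> ?R")
  proof
    assume ?L
    then obtain v where "rec_nat F (\<lambda>l y. Option.bind y (G l)) k = Some v" and v: "G k v = Some y"
      by (auto simp: bind_eq_Some_conv)
    then obtain w where w: "F = Some (w 0)" "\<forall>l<k. G l (w l) = Some (w (Suc l))" "w k = v"
      using Suc by blast
    show ?R
    proof (intro exI conjI allI impI)
      show "F = Some ((w(Suc k := y)) 0)" using w by simp
      show "G l ((w(Suc k := y)) l) = Some ((w(Suc k := y)) (Suc l))" if "l < Suc k" for l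
        using that w v by (cases "l = k") auto
    qed simp
  next
    assume ?R
    then obtain w where w: "F = Some (w 0)" "\<forall>l<Suc k. G l (w l) = Some (w (Suc l))" "w (Suc k) = y"
      by blast
    then have "rec_nat F (\<lambda>l y. Option.bind y (G l)) k = Some (w k)" using Suc by auto
    then show ?L using w by simp
  qed
qed

text \<open>The intermediate values form a sequence whose length depends on \<open>k\<close>; two
  numbers code it, which leaves numerical quantifiers only.\<close>

lemma primrec_eq_Some_iff_beta:
  "rec_nat F (\<lambda>l y. Option.bind y (G l)) k = Some y \<longleftrightarrow>
    (\<exists>c T. F = Some (beta c T 0) \<and> (\<forall>l<k. G l (beta c T l) = Some (beta c T (Suc l))) \<and> beta c T k = y)"
    (is "?L \<longleftrightarrow> ?R")
proof
  assume ?L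
  then obtain w where w: "F = Some (w 0)" "\<forall>l<k. G l (w l) = Some (w (Suc l))" "w k = y"
    unfolding primrec_eq_Some_iff by blast
  obtain c T where b: "\<And>l. l < Suc k \<Longrightarrow> beta c T l = w l" using beta_exists[of "Suc k" w] by blast
  have "F = Some (beta c T 0)" "\<forall>l<k. G l (beta c T l) = Some (beta c T (Suc l))" "beta c T k = y"
    using w by (simp_all add: b)
  then show ?R by blast
qed (unfold primrec_eq_Some_iff, blast)

lemma rec_eval_Mu_eq_Some_iff:
  "rec_eval (Mu f) xs = Some y \<longleftrightarrow>
    rec_eval f (y # xs) = Some 0 \<and> (\<forall>l<y. \<exists>v. rec_eval f (l # xs) = Some (Suc v))" (is "?L \<longleftrightarrow> ?R")
proof
  assume L: ?L
  then obtain k where k: "rec_eval f (k # xs) = Some 0" "\<And>l. l < k \<Longrightarrow> rec_eval f (l # xs) \<noteq> None"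
    and y: "y = (LEAST k. rec_eval f (k # xs) = Some 0)" by (auto split: if_splits)
  have "y \<le> k" unfolding y using k(1) by (rule Least_le)
  have "rec_eval f (y # xs) = Some 0" unfolding y using k(1) by (rule LeastI)
  moreover have "\<exists>v. rec_eval f (l # xs) = Some (Suc v)" if "l < y" for l
  proof -
    have "l < k" using that \<open>y \<le> k\<close> by simp
    then obtain v where v: "rec_eval f (l # xs) = Some v" using k(2) by blast
    moreover have "rec_eval f (l # xs) \<noteq> Some 0" using that not_less_Least unfolding y by blast
    ultimately show ?thesis by (cases v) auto
  qed
  ultimately show ?R by blast
next
  assume R: ?R
  have "(LEAST k. rec_eval f (k # xs) = Some 0) = y"
  proof (rule Least_equality)
    show "y \<le> z" if "rec_eval f (z # xs) = Some 0" for z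
    proof (rule ccontr)
      assume "\<not> y \<le> z"
      then obtain v where "rec_eval f (z # xs) = Some (Suc v)" using R by force
      then show False using that by simp
    qed
  qed (use R in blast)
  moreover have "\<exists>k. rec_eval f (k # xs) = Some 0 \<and> (\<forall>l<k. rec_eval f (l # xs) \<noteq> None)"
    using R by (intro exI[of _ y]) auto
  ultimately show ?L by simp
qed

lemma rec_eval_Comp_eq_Some_iff:
  "rec_eval (Comp f gs) xs = Some y \<longleftrightarrow>
    (\<exists>ys. list_all2 (\<lambda>g y. rec_eval g xs = Some y) gs ys \<and> rec_eval f ys = Some y)" (is "?L \<longleftrightarrow> ?R")
proof
  assume ?L
  then have *: "None \<notin> set (map (\<lambda>g. rec_eval g xs) gs)"
    "rec_eval f (map the (map (\<lambda>g. rec_eval g xs) gs)) = Some y"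
    by (auto simp: Let_def split: if_splits)
  have "list_all2 (\<lambda>g y. rec_eval g xs = Some y) gs (map the (map (\<lambda>g. rec_eval g xs) gs))"
    using *(1) by (induction gs) auto
  then show ?R using *(2) by blast
next
  assume ?R
  then obtain ys where ys: "list_all2 (\<lambda>g y. rec_eval g xs = Some y) gs ys" "rec_eval f ys = Some y"
    by blast
  have "map (\<lambda>g. rec_eval g xs) gs = map Some ys" using ys(1) by induction auto
  then show ?L using ys(2) by (auto simp: Let_def comp_def)
qed

text \<open>Arguments and result are arbitrary Diophantine functions, because subprograms run on
  bound variables and on coded values.\<close>

lemma dioph_rec_eval:
  assumes "\<forall>h\<in>set hs. dfun h" "dfun g"
  shows "dioph (\<lambda>e. rec_eval f (map (\<lambda>h. h e) hs) = Some (g e))"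
  using assms
proof (induction f arbitrary: hs g)
  case Zero
  then show ?case by (simp add: dioph_eq dfun_const)
next
  case Succ
  then show ?case by (cases hs) (simp_all add: dioph_False dioph_eq dfun_Suc)
next
  case (Proj i)
  then show ?case by (cases "i < length hs") (simp_all add: dioph_False dioph_eq)
next
  case (Comp f gs)
  have shift: "map (\<lambda>h. h (\<lambda>i. e (Suc i))) hs = map (\<lambda>h. h e) (map (\<lambda>h e. h (\<lambda>i. e (Suc i))) hs)"
    for hs :: "((nat \<Rightarrow> nat) \<Rightarrow> nat) list" and e by simp
  \<comment> \<open>The quantifier over the list \<open>ys\<close> is peeled off value by value;
    \<open>acc\<close> collects the values bound so far.\<close>
  have "dioph (\<lambda>e. \<exists>ys. list_all2 (\<lambda>g y. rec_eval g (map (\<lambda>h. h e) hs) = Some y) gs' ys \<and>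
      rec_eval f (map (\<lambda>h. h e) acc @ ys) = Some (g e))"
    if "set gs' \<subseteq> set gs" "\<forall>h\<in>set hs. dfun h" "\<forall>h\<in>set acc. dfun h" "dfun g" for gs' hs acc g
    using that
  proof (induction gs' arbitrary: hs acc g)
    case Nil
    then show ?case using Comp.IH(1) by simp
  next
    case (Cons g0 gs')
    have "dioph (\<lambda>e. rec_eval g0 (map (\<lambda>h. h (\<lambda>i. e (Suc i))) hs) = Some (e 0))"
      unfolding shift
      by (rule Comp.IH(2)) (use Cons.prems in \<open>auto intro: dfun_shift dfun_var\<close>)
    moreover have "dioph (\<lambda>e. \<exists>ys. list_all2 (\<lambda>g y. rec_eval g (map (\<lambda>h. h (\<lambda>i. e (Suc i))) hs) = Some y) gs' ys \<and>
      rec_eval f (map (\<lambda>h. h (\<lambda>i. e (Suc i))) acc @ e 0 # ys) = Some (g (\<lambda>i. e (Suc i))))"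
      using Cons.IH[of "map (\<lambda>h e. h (\<lambda>i. e (Suc i))) hs" "map (\<lambda>h e. h (\<lambda>i. e (Suc i))) acc @ [\<lambda>e. e 0]"
          "\<lambda>e. g (\<lambda>i. e (Suc i))"] Cons.prems
      by (auto simp: dfun_shift dfun_var comp_def)
    ultimately have "dioph (\<lambda>e. \<exists>y. rec_eval g0 (map (\<lambda>h. h e) hs) = Some y \<and>
      (\<exists>ys. list_all2 (\<lambda>g y. rec_eval g (map (\<lambda>h. h e) hs) = Some y) gs' ys \<and>
      rec_eval f (map (\<lambda>h. h e) acc @ y # ys) = Some (g e)))"
      by (intro dioph_ex dioph_conj)
    moreover have "(\<exists>ys. list_all2 P (g0 # gs') ys \<and> Q ys) \<longleftrightarrow> (\<exists>y. P g0 y \<and> (\<exists>ys. list_all2 P gs' ys \<and> Q (y # ys)))"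
      for P :: "recf \<Rightarrow> nat \<Rightarrow> bool" and Q by (auto simp: list_all2_Cons1)
    ultimately show ?case by simp
  qed
  from this[of gs hs "[]" g] show ?case using Comp.prems unfolding rec_eval_Comp_eq_Some_iff by simp
next
  case (PrimRec f g0)
  show ?case
  proof (cases hs)
    case Nil
    then show ?thesis by (simp add: dioph_False)
  next
    case (Cons k zs)
    have k: "dfun k" and zs2: "\<forall>h\<in>set zs. dfun (\<lambda>e. h (\<lambda>i. e (Suc (Suc i))))"
      and zs3: "\<forall>h\<in>set zs. dfun (\<lambda>e. h (\<lambda>i. e (Suc (Suc (Suc i)))))"
      using PrimRec.prems(1) Cons by (auto intro: dfun_rename)
    \<comment> \<open>Behind the quantifiers for \<open>c\<close> and \<open>T\<close>,
      \<open>e 0\<close> is \<open>T\<close> and \<open>e (Suc 0)\<close> is \<open>c\<close>. Below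
      the bounded quantifier both move up by one.\<close>
    have "dioph (\<lambda>e. rec_eval f (map (\<lambda>h. h e) (map (\<lambda>h e. h (\<lambda>i. e (Suc (Suc i)))) zs))
        = Some (beta (e (Suc 0)) (e 0) 0))"
      by (rule PrimRec.IH(1)) (use zs2 in \<open>simp_all add: dfun_var dfun_const dfun_beta\<close>)
    then have F: "dioph (\<lambda>e. rec_eval f (map (\<lambda>h. h (\<lambda>i. e (Suc (Suc i)))) zs) = Some (beta (e (Suc 0)) (e 0) 0))"
      by (simp add: comp_def)
    have "dioph (\<lambda>e. rec_eval g0 (map (\<lambda>h. h e) ((\<lambda>e. e 0) # (\<lambda>e. beta (e (Suc (Suc 0))) (e (Suc 0)) (e 0))
        # map (\<lambda>h e. h (\<lambda>i. e (Suc (Suc (Suc i))))) zs)) = Some (beta (e (Suc (Suc 0))) (e (Suc 0)) (Suc (e 0))))"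
      by (rule PrimRec.IH(2)) (use zs3 in \<open>simp_all add: dfun_var dfun_Suc dfun_beta\<close>)
    then have G: "dioph (\<lambda>e. rec_eval g0 (e 0 # beta (e (Suc (Suc 0))) (e (Suc 0)) (e 0)
        # map (\<lambda>h. h (\<lambda>i. e (Suc (Suc (Suc i))))) zs) = Some (beta (e (Suc (Suc 0))) (e (Suc 0)) (Suc (e 0))))"
      by (simp add: comp_def)
    have "dioph (\<lambda>e. \<exists>c T. rec_eval f (map (\<lambda>h. h e) zs) = Some (beta c T 0) \<and>
      (\<forall>l<k e. rec_eval g0 (l # beta c T l # map (\<lambda>h. h e) zs) = Some (beta c T (Suc l))) \<and> beta c T (k e) = g e)"
      by (intro dioph_ex dioph_conj dioph_bounded_all dioph_eq F G dfun_beta dfun_var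
          dfun_rename[OF k] dfun_rename[OF PrimRec.prems(2)])
    then show ?thesis using Cons by (simp add: primrec_eq_Some_iff_beta)
  qed
next
  case (Mu f)
  have "dioph (\<lambda>e. rec_eval f (g e # map (\<lambda>h. h e) hs) = Some 0)"
    using Mu.IH[of "g # hs" "\<lambda>_. 0"] Mu.prems by (simp add: dfun_const)
  moreover have "dioph (\<lambda>e. rec_eval f (map (\<lambda>h. h e) ((\<lambda>e. e (Suc 0)) #
      map (\<lambda>h e. h (\<lambda>i. e (Suc (Suc i)))) hs)) = Some (Suc (e 0)))"
    by (rule Mu.IH) (use Mu.prems(1) in \<open>auto intro: dfun_rename dioph_intros\<close>)
  then have "dioph (\<lambda>e. rec_eval f (e (Suc 0) # map (\<lambda>h. h (\<lambda>i. e (Suc (Suc i)))) hs) = Some (Suc (e 0)))"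
    by (simp add: comp_def)
  ultimately have "dioph (\<lambda>e. rec_eval f (g e # map (\<lambda>h. h e) hs) = Some 0 \<and>
    (\<forall>l<g e. \<exists>v. rec_eval f (l # map (\<lambda>h. h e) hs) = Some (Suc v)))"
    using Mu.prems(2) by (intro dioph_intros)
  then show ?case unfolding rec_eval_Mu_eq_Some_iff .
qed

section \<open>Sums of four squares\<close>

definition sum4 :: "int \<Rightarrow> bool" where
  "sum4 n \<longleftrightarrow> (\<exists>a b c d. n = a\<^sup>2 + b\<^sup>2 + c\<^sup>2 + d\<^sup>2)"

text \<open>Multiplicativity of the norm of quaternions.\<close>

lemma euler_four_squares:
  fixes a b c d w x y z :: int
  shows "(a\<^sup>2 + b\<^sup>2 + c\<^sup>2 + d\<^sup>2) * (w\<^sup>2 + x\<^sup>2 + y\<^sup>2 + z\<^sup>2) =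
    (a * w + b * x + c * y + d * z)\<^sup>2 + (a * x - b * w + c * z - d * y)\<^sup>2 +
    (a * y - b * z - c * w + d * x)\<^sup>2 + (a * z + b * y - c * x - d * w)\<^sup>2"
  by (simp add: power2_eq_square algebra_simps)

lemma sum4_mult: "sum4 m \<Longrightarrow> sum4 n \<Longrightarrow> sum4 (m * n)"
  unfolding sum4_def using euler_four_squares by metis

lemma exists_centered_residue:
  fixes a m :: int
  assumes "m > 0"
  shows "\<exists>b. m dvd a - b \<and> 2 * \<bar>b\<bar> \<le> m"
proof (intro exI conjI)
  let ?b = "(a + m div 2) mod m - m div 2"
  have "a - ?b = (a + m div 2) - (a + m div 2) mod m" by simp
  then show "m dvd a - ?b" by (simp only: dvd_minus_mod)
  have "0 \<le> (a + m div 2) mod m" "(a + m div 2) mod m < m" using assms by simp_all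
  moreover have "2 * (m div 2) \<le> m" "m \<le> 2 * (m div 2) + 1" by presburger+
  moreover have "2 * \<bar>r - q\<bar> \<le> m" if "0 \<le> r" "r < m" "2 * q \<le> m" "m \<le> 2 * q + 1" for r q
    using that by (cases "q \<le> r") simp_all
  ultimately show "2 * \<bar>?b\<bar> \<le> m" by blast
qed

lemma sq_dvd_diff_squares:
  fixes a b m :: int
  assumes "m dvd a - b" "m dvd 2 * b"
  shows "m\<^sup>2 dvd a\<^sup>2 - b\<^sup>2"
proof -
  have "a\<^sup>2 - b\<^sup>2 = (a - b) * ((a - b) + 2 * b)" by (simp add: power2_eq_square algebra_simps)
  moreover have "m * m dvd (a - b) * ((a - b) + 2 * b)"
    using assms by (intro mult_dvd_mono dvd_add)
  ultimately show ?thesis by (simp add: power2_eq_square)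
qed

text \<open>Lagrange's descent: residues modulo \<open>m\<close> of absolute value at most
  \<open>m / 2\<close> give a sum of four squares \<open>m * r\<close> with
  \<open>r \<le> m\<close>. By Euler's identity, its product with \<open>m * p\<close> is a sum of
  squares of multiples of \<open>m\<close>, and division by \<open>m\<^sup>2\<close> leaves
  \<open>r * p\<close>.\<close>

lemma four_squares_descent:
  fixes m p :: int
  assumes p: "prime p" and m: "1 < m" "m < p" and s: "sum4 (m * p)"
  shows "\<exists>r. 1 \<le> r \<and> r < m \<and> sum4 (r * p)"
proof -
  obtain a b c d where abcd: "m * p = a\<^sup>2 + b\<^sup>2 + c\<^sup>2 + d\<^sup>2" using s unfolding sum4_def by blast
  have "\<exists>x. m dvd a - x \<and> 2 * \<bar>x\<bar> \<le> m" for a using m by (intro exists_centered_residue) simp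
  then obtain w x y z where w: "m dvd a - w" "2 * \<bar>w\<bar> \<le> m" and x: "m dvd b - x" "2 * \<bar>x\<bar> \<le> m"
    and y: "m dvd c - y" "2 * \<bar>y\<bar> \<le> m" and z: "m dvd d - z" "2 * \<bar>z\<bar> \<le> m" by metis
  have dsq: "m dvd u\<^sup>2 - v\<^sup>2" if "m dvd u - v" for u v
  proof -
    have "u\<^sup>2 - v\<^sup>2 = (u - v) * (u + v)" by (simp add: power2_eq_square algebra_simps)
    then show ?thesis using that by simp
  qed
  have sq: "4 * v\<^sup>2 \<le> m\<^sup>2" if "2 * \<bar>v\<bar> \<le> m" for v
    using power_mono[OF that, of 2] by (simp add: power_mult_distrib)
  have "m dvd m * p - ((a\<^sup>2 - w\<^sup>2) + (b\<^sup>2 - x\<^sup>2) + (c\<^sup>2 - y\<^sup>2) + (d\<^sup>2 - z\<^sup>2))"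
    by (intro dvd_diff dvd_add dsq dvd_triv_left w(1) x(1) y(1) z(1))
  moreover have "m * p - ((a\<^sup>2 - w\<^sup>2) + (b\<^sup>2 - x\<^sup>2) + (c\<^sup>2 - y\<^sup>2) + (d\<^sup>2 - z\<^sup>2)) = w\<^sup>2 + x\<^sup>2 + y\<^sup>2 + z\<^sup>2"
    using abcd by linarith
  ultimately have "m dvd w\<^sup>2 + x\<^sup>2 + y\<^sup>2 + z\<^sup>2" by simp
  then obtain r where r: "w\<^sup>2 + x\<^sup>2 + y\<^sup>2 + z\<^sup>2 = m * r" by blast
  have "m * r \<le> m * m" using sq[OF w(2)] sq[OF x(2)] sq[OF y(2)] sq[OF z(2)] r
    unfolding power2_eq_square[of m] by linarith
  then have rm: "r \<le> m" using m by simp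
  have "0 \<le> m * r" unfolding r[symmetric] by simp
  then have r0: "0 \<le> r" using m by (simp add: zero_le_mult_iff)
  have "\<not> m dvd p"
  proof
    assume "m dvd p"
    moreover have "0 \<le> m" using m by simp
    ultimately have "m = 1 \<or> m = p" using p unfolding prime_int_iff by blast
    then show False using m by simp
  qed
  \<comment> \<open>In the extremal cases all residues are 0 or all are \<open>m / 2\<close> up to
    sign. Either way replacing the terms by residues preserves squares modulo
    \<open>m\<^sup>2\<close>, which would force \<open>m dvd p\<close>.\<close>
  have "r \<noteq> 0 \<and> r \<noteq> m"
  proof (rule ccontr)
    assume "\<not> (r \<noteq> 0 \<and> r \<noteq> m)"
    then have r': "r = 0 \<or> r = m" by blast
    have half: "m dvd 2 * v" if v: "v \<in> {w, x, y, z}" for v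
      using r'
    proof
      assume "r = 0"
      then have "v\<^sup>2 = 0" using r v by (simp add: add_nonneg_eq_0_iff)
      then show ?thesis by simp
    next
      assume "r = m"
      then have "4 * v\<^sup>2 = m\<^sup>2"
        using r v sq[OF w(2)] sq[OF x(2)] sq[OF y(2)] sq[OF z(2)] by (auto simp: power2_eq_square)
      then have "(2 * v)\<^sup>2 = m\<^sup>2" by (simp add: power_mult_distrib)
      then have "2 * v = m \<or> 2 * v = - m" by (simp only: power2_eq_iff)
      then show ?thesis by auto
    qed
    have "m\<^sup>2 dvd (a\<^sup>2 - w\<^sup>2) + (b\<^sup>2 - x\<^sup>2) + (c\<^sup>2 - y\<^sup>2) + (d\<^sup>2 - z\<^sup>2)"
      using w x y z half by (intro dvd_add sq_dvd_diff_squares) auto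
    then have "m\<^sup>2 dvd m * p - m * r" using abcd r by (simp add: algebra_simps)
    then have "m dvd p - r" using m by (simp add: power2_eq_square right_diff_distrib[symmetric])
    moreover have "m dvd r" using r' by auto
    ultimately have "m dvd p" using dvd_add[of m "p - r" r] by simp
    then show False using \<open>\<not> m dvd p\<close> by blast
  qed
  then have r1: "1 \<le> r" "r < m" using r0 rm by auto
  \<comment> \<open>Replacing the residues by \<open>a\<close>, \<open>b\<close>, \<open>c\<close>,
    \<open>d\<close> turns the first form into \<open>m * p\<close> and makes the others
    cancel.\<close>
  have dvd: "m dvd a * w + b * x + c * y + d * z" "m dvd a * x - b * w + c * z - d * y"
    "m dvd a * y - b * z - c * w + d * x" "m dvd a * z + b * y - c * x - d * w"
  proof -
    have c: "[w = a] (mod m)" "[x = b] (mod m)" "[y = c] (mod m)" "[z = d] (mod m)"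
      using w x y z by (auto simp: cong_iff_dvd_diff dvd_diff_commute)
    have "[a * w + b * x + c * y + d * z = a * a + b * b + c * c + d * d] (mod m)"
      by (intro cong_add cong_mult c cong_refl)
    moreover have "m dvd a * a + b * b + c * c + d * d"
      using abcd unfolding power2_eq_square by (metis dvd_triv_left)
    ultimately show "m dvd a * w + b * x + c * y + d * z" by (simp add: cong_dvd_iff)
    have "[a * x - b * w + c * z - d * y = a * b - b * a + c * d - d * c] (mod m)"
      by (intro cong_add cong_diff cong_mult c cong_refl)
    then show "m dvd a * x - b * w + c * z - d * y" by (simp add: cong_0_iff mult.commute)
    have "[a * y - b * z - c * w + d * x = a * c - b * d - c * a + d * b] (mod m)"
      by (intro cong_add cong_diff cong_mult c cong_refl)
    then show "m dvd a * y - b * z - c * w + d * x" by (simp add: cong_0_iff mult.commute)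
    have "[a * z + b * y - c * x - d * w = a * d + b * c - c * b - d * a] (mod m)"
      by (intro cong_add cong_diff cong_mult c cong_refl)
    then show "m dvd a * z + b * y - c * x - d * w" by (simp add: cong_0_iff mult.commute)
  qed
  then obtain A B C D where ABCD: "a * w + b * x + c * y + d * z = m * A" "a * x - b * w + c * z - d * y = m * B"
    "a * y - b * z - c * w + d * x = m * C" "a * z + b * y - c * x - d * w = m * D"
    by (metis dvdE)
  have "(m * p) * (m * r) = (m * A)\<^sup>2 + (m * B)\<^sup>2 + (m * C)\<^sup>2 + (m * D)\<^sup>2"
    unfolding abcd r[symmetric] ABCD[symmetric] by (rule euler_four_squares)
  then have "(m * m) * (r * p) = (m * m) * (A\<^sup>2 + B\<^sup>2 + C\<^sup>2 + D\<^sup>2)"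
    by (simp add: power2_eq_square algebra_simps)
  then have "r * p = A\<^sup>2 + B\<^sup>2 + C\<^sup>2 + D\<^sup>2" using m by simp
  then show ?thesis using r1 unfolding sum4_def by blast
qed

text \<open>Pigeonhole: the \<open>h + 1\<close> squares are distinct modulo
  \<open>2 * h + 1\<close>, and so are the \<open>h + 1\<close> numbers
  \<open>- b\<^sup>2 - 1\<close>; the two sets of residues must meet.\<close>

lemma prime_dvd_sum_two_squares_plus_1:
  fixes h :: int
  assumes p: "prime (2 * h + 1)"
  shows "\<exists>a b. 0 \<le> a \<and> a \<le> h \<and> 0 \<le> b \<and> b \<le> h \<and> 2 * h + 1 dvd a\<^sup>2 + b\<^sup>2 + 1"
proof -
  define p where "p = 2 * h + 1"
  have pp: "prime p" using p by (simp add: p_def)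
  have h: "h \<ge> 1" using pp prime_ge_2_int[OF pp] by (simp add: p_def)
  have inj: "a = b" if ab: "a \<in> {0..h}" "b \<in> {0..h}" "p dvd a\<^sup>2 - b\<^sup>2" for a b
  proof -
    have "a\<^sup>2 - b\<^sup>2 = (a - b) * (a + b)" by (simp add: power2_eq_square algebra_simps)
    then consider "p dvd a - b" | "p dvd a + b"
      using ab(3) pp by (metis prime_dvd_mult_iff)
    then show ?thesis
    proof cases
      case 1
      have "\<bar>a - b\<bar> < p" using ab by (auto simp: p_def)
      then show ?thesis using dvd_imp_le_int[OF _ 1] by (cases "a = b") auto
    next
      case 2
      then show ?thesis using ab zdvd_imp_le[OF 2] by (cases "a + b = 0") (auto simp: p_def)
    qed
  qed
  have p0: "p > 0" using h by (simp add: p_def)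
  define A B where "A = (\<lambda>a. a\<^sup>2 mod p) ` {0..h}" and "B = (\<lambda>b. (- b\<^sup>2 - 1) mod p) ` {0..h}"
  have "inj_on (\<lambda>a. a\<^sup>2 mod p) {0..h}"
    by (intro inj_onI inj) (auto simp: mod_eq_dvd_iff)
  then have "card A = nat (h + 1)" unfolding A_def by (simp add: card_image)
  moreover have "inj_on (\<lambda>b. (- b\<^sup>2 - 1) mod p) {0..h}"
  proof (intro inj_onI)
    fix a b assume ab: "a \<in> {0..h}" "b \<in> {0..h}" "(- a\<^sup>2 - 1) mod p = (- b\<^sup>2 - 1) mod p"
    then have "p dvd b\<^sup>2 - a\<^sup>2" by (simp add: mod_eq_dvd_iff)
    then show "a = b" using inj[OF ab(2,1)] by simp
  qed
  then have "card B = nat (h + 1)" unfolding B_def by (simp add: card_image)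
  moreover have "A \<union> B \<subseteq> {0..<p}" unfolding A_def B_def using p0 by auto
  then have "card (A \<union> B) \<le> card {0..<p}" by (intro card_mono) auto
  then have "card (A \<union> B) \<le> nat p" by simp
  moreover have "finite A" "finite B" by (simp_all add: A_def B_def)
  ultimately have "A \<inter> B \<noteq> {}" using h card_Un_disjoint[of A B] by (auto simp: p_def)
  then obtain a b where ab: "a \<in> {0..h}" "b \<in> {0..h}" "a\<^sup>2 mod p = (- b\<^sup>2 - 1) mod p"
    unfolding A_def B_def by blast
  then have "p dvd a\<^sup>2 + b\<^sup>2 + 1" by (simp add: mod_eq_dvd_iff algebra_simps)
  then show ?thesis using ab unfolding p_def by auto
qed

text \<open>For odd \<open>p\<close>, the multiple \<open>a\<^sup>2 + b\<^sup>2 + 1\<close> of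
  \<open>p\<close> is smaller than \<open>p * p\<close>, so the descent starts below
  \<open>p\<close> and ends at the multiplier 1.\<close>

lemma sum4_prime:
  fixes p :: int
  assumes p: "prime p" shows "sum4 p"
proof (cases "p = 2")
  case True
  then have "p = 1\<^sup>2 + 1\<^sup>2 + 0\<^sup>2 + 0\<^sup>2" by simp
  then show ?thesis unfolding sum4_def by blast
next
  case False
  then have "odd p" using p prime_ge_2_int[OF p] by (intro prime_odd_int) auto
  then obtain h where h: "p = 2 * h + 1" by (elim oddE)
  have h1: "h \<ge> 1" using prime_ge_2_int[OF p] h by simp
  obtain a b where ab: "0 \<le> a" "a \<le> h" "0 \<le> b" "b \<le> h" "p dvd a\<^sup>2 + b\<^sup>2 + 1"
    using prime_dvd_sum_two_squares_plus_1[of h] p h by auto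
  obtain m where m: "a\<^sup>2 + b\<^sup>2 + 1 = p * m" using ab(5) by blast
  have "a\<^sup>2 + b\<^sup>2 + 1 > 0" by (simp add: add_nonneg_pos)
  then have m1: "m \<ge> 1" using m prime_gt_0_int[OF p] by (simp add: zero_less_mult_iff)
  have "a\<^sup>2 \<le> h\<^sup>2" "b\<^sup>2 \<le> h\<^sup>2" using ab by (simp_all add: power_mono)
  moreover have "p * p = 4 * h\<^sup>2 + 4 * h + 1" unfolding h by (simp add: power2_eq_square algebra_simps)
  ultimately have "p * m < p * p" using m h1 zero_le_power2[of h] by linarith
  then have "m < p" using prime_gt_0_int[OF p] by simp
  moreover have "sum4 (m * p)" unfolding sum4_def
    using m by (intro exI[of _ a] exI[of _ b] exI[of _ 1] exI[of _ 0]) (simp add: mult.commute)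
  ultimately show ?thesis using m1
  proof (induction "nat m" arbitrary: m rule: less_induct)
    case less
    show ?case
    proof (cases "m = 1")
      case False
      then obtain r where "1 \<le> r" "r < m" "sum4 (r * p)"
        using four_squares_descent[OF p, of m] less.prems by auto
      then show ?thesis using less.hyps[of r] less.prems by auto
    qed (use less.prems in simp)
  qed
qed

theorem four_squares: "sum4 (int n)"
proof (induction n rule: prime_divisors_induct)
  case zero
  have "int 0 = 0\<^sup>2 + 0\<^sup>2 + 0\<^sup>2 + 0\<^sup>2" by simp
  then show ?case unfolding sum4_def by blast
next
  case (unit x)
  then have "int x = 1\<^sup>2 + 0\<^sup>2 + 0\<^sup>2 + 0\<^sup>2" by simp
  then show ?case unfolding sum4_def by blast
next
  case (factor p x)
  then show ?case using sum4_mult[OF sum4_prime[of "int p"]] by simp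
qed

section \<open>Integral bilinear forms\<close>

text \<open>Elimination without fractions: a pivot vector \<open>u p\<close> clears the last
  coordinate of the others, and its own coefficient is recovered afterwards.\<close>

lemma exists_integer_relation:
  fixes u :: "'i \<Rightarrow> nat \<Rightarrow> int"
  assumes "finite I" "card I > m"
  shows "\<exists>c. (\<exists>i\<in>I. c i \<noteq> 0) \<and> (\<forall>t<m. (\<Sum>i\<in>I. c i * u i t) = 0)"
  using assms
proof (induction m arbitrary: I u)
  case 0
  then show ?case by (intro exI[of _ "\<lambda>_. 1"]) (auto simp: card_gt_0_iff)
next
  case (Suc m)
  show ?case
  proof (cases "\<forall>i\<in>I. u i m = 0")
    case True
    obtain c where "\<exists>i\<in>I. c i \<noteq> 0" "\<forall>t<m. (\<Sum>i\<in>I. c i * u i t) = 0"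
      using Suc.IH[of I u] Suc.prems by auto
    then show ?thesis using True by (intro exI[of _ c]) (auto simp: less_Suc_eq)
  next
    case False
    then obtain p where p: "p \<in> I" "u p m \<noteq> 0" by blast
    have "card (I - {p}) > m" using p Suc.prems by simp
    then obtain c where c: "\<exists>i\<in>I - {p}. c i \<noteq> 0"
      "\<And>t. t < m \<Longrightarrow> (\<Sum>i\<in>I - {p}. c i * (u p m * u i t - u i m * u p t)) = 0"
      using Suc.IH[of "I - {p}" "\<lambda>i t. u p m * u i t - u i m * u p t"] Suc.prems by auto
    define c' where "c' i = (if i = p then - (\<Sum>i\<in>I - {p}. c i * u i m) else u p m * c i)" for i
    have "(\<Sum>i\<in>I. c' i * u i t) = (\<Sum>i\<in>I - {p}. c i * (u p m * u i t - u i m * u p t))" for t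
    proof -
      have "(\<Sum>i\<in>I. c' i * u i t) = c' p * u p t + (\<Sum>i\<in>I - {p}. c' i * u i t)"
        using p Suc.prems by (simp add: sum.remove)
      also have "(\<Sum>i\<in>I - {p}. c' i * u i t) = (\<Sum>i\<in>I - {p}. u p m * c i * u i t)"
        by (intro sum.cong) (auto simp: c'_def)
      finally show ?thesis
        by (simp add: c'_def sum_distrib_left sum_distrib_right sum_subtractf right_diff_distrib mult_ac)
    qed
    moreover have "(\<Sum>i\<in>I - {p}. c i * (u p m * u i m - u i m * u p m)) = 0"
      by (simp add: mult.commute)
    ultimately have "\<forall>t<Suc m. (\<Sum>i\<in>I. c' i * u i t) = 0" using c(2) by (simp add: less_Suc_eq)
    moreover have "\<exists>i\<in>I. c' i \<noteq> 0" using c(1) p by (auto simp: c'_def)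
    ultimately show ?thesis by blast
  qed
qed

context
  fixes B :: "int mat" and m n :: nat
  assumes B: "B \<in> carrier_mat m n"
begin

definition bform :: "int vec \<Rightarrow> int vec \<Rightarrow> int" where
  "bform u v = u \<bullet> (B *\<^sub>v v)"

lemma mult_mat_vec_smult: "v \<in> carrier_vec n \<Longrightarrow> B *\<^sub>v (c \<cdot>\<^sub>v v) = c \<cdot>\<^sub>v (B *\<^sub>v v)"
  using B by (intro eq_vecI) auto

lemma bform_left:
  assumes "u \<in> carrier_vec m" "u' \<in> carrier_vec m" "v \<in> carrier_vec n"
  shows "bform (u + c \<cdot>\<^sub>v u') v = bform u v + c * bform u' v"
proof -
  have "B *\<^sub>v v \<in> carrier_vec m" using B assms by simp
  then show ?thesis unfolding bform_def using assms
    by (simp add: add_scalar_prod_distrib[of _ m])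
qed

lemma bform_right:
  assumes "u \<in> carrier_vec m" "v \<in> carrier_vec n" "v' \<in> carrier_vec n"
  shows "bform u (v + c \<cdot>\<^sub>v v') = bform u v + c * bform u v'"
proof -
  have "B *\<^sub>v v \<in> carrier_vec m" "B *\<^sub>v v' \<in> carrier_vec m" using B assms by simp_all
  moreover have "B *\<^sub>v (v + c \<cdot>\<^sub>v v') = B *\<^sub>v v + c \<cdot>\<^sub>v (B *\<^sub>v v')"
    using B assms by (simp add: mult_add_distrib_mat_vec[of _ m n] mult_mat_vec_smult)
  ultimately show ?thesis unfolding bform_def using assms
    by (simp add: scalar_prod_add_distrib[of _ m])
qed

lemma bform_smult:
  assumes "u \<in> carrier_vec m" "v \<in> carrier_vec n"
  shows "bform (c \<cdot>\<^sub>v u) v = c * bform u v" "bform u (c \<cdot>\<^sub>v v) = c * bform u v"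
proof -
  have "B *\<^sub>v v \<in> carrier_vec m" using B assms by simp
  then show "bform (c \<cdot>\<^sub>v u) v = c * bform u v" "bform u (c \<cdot>\<^sub>v v) = c * bform u v"
    unfolding bform_def using assms B by (simp_all add: mult_mat_vec_smult)
qed

lemma bform_unit:
  assumes "i < m" "j < n" shows "bform (unit_vec m i) (unit_vec n j) = B $$ (i, j)"
  unfolding bform_def using B assms by (simp add: scalar_prod_left_unit)

text \<open>Shifting \<open>x\<close> and \<open>y\<close> by multiples of the minimising pair \<open>(u, v)\<close> makes them orthogonal to it;
  then \<open>(u + x, v)\<close> attains the minimum as well, and minimality applies to the pair \<open>(u + x, y)\<close>.\<close>

lemma minimal_value:
  assumes "B \<noteq> 0\<^sub>m m n"
  obtains d u v where "d > 0" "u \<in> carrier_vec m" "v \<in> carrier_vec n" "bform u v = d"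
    "\<And>x y. x \<in> carrier_vec m \<Longrightarrow> y \<in> carrier_vec n \<Longrightarrow> d dvd bform x y"
proof -
  let ?P = "\<lambda>d. 0 < d \<and> (\<exists>u\<in>carrier_vec m. \<exists>v\<in>carrier_vec n. bform u v = int d)"
  obtain i j where ij: "i < m" "j < n" "B $$ (i, j) \<noteq> 0"
    using assms B by (metis carrier_matD eq_matI index_zero_mat)
  have "\<exists>d. ?P d"
  proof (intro exI conjI bexI)
    let ?c = "sgn (B $$ (i, j))"
    show "bform (?c \<cdot>\<^sub>v unit_vec m i) (unit_vec n j) = int (nat \<bar>B $$ (i, j)\<bar>)"
      using ij by (simp add: bform_smult bform_unit sgn_if)
    show "0 < nat \<bar>B $$ (i, j)\<bar>" using ij by simp
  qed auto
  define d where "d = (LEAST d. ?P d)"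
  have Pd: "?P d" unfolding d_def using \<open>\<exists>d. ?P d\<close> by (rule LeastI_ex)
  have least: "d \<le> d'" if "?P d'" for d' unfolding d_def using that by (rule Least_le)
  have zero: "b = 0" if "x \<in> carrier_vec m" "y \<in> carrier_vec n" "bform x y = b" "0 \<le> b" "b < int d"
    for x y b
  proof (rule ccontr)
    assume "b \<noteq> 0"
    then have "?P (nat b)" using that by auto
    then show False using least[of "nat b"] that by linarith
  qed
  have step: "int d dvd bform u y \<and> int d dvd bform x v"
    if uv: "u \<in> carrier_vec m" "v \<in> carrier_vec n" "bform u v = int d"
      and xy: "x \<in> carrier_vec m" "y \<in> carrier_vec n" for u v x y
  proof
    \<comment> \<open>Subtracting the quotient times \<open>v\<close> from \<open>y\<close> turns
      the value into its remainder modulo \<open>d\<close>, which minimality forces to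
      vanish.\<close>
    have "bform u (y + (- (bform u y div int d)) \<cdot>\<^sub>v v) = bform u y mod int d"
      using uv xy by (simp add: bform_right minus_div_mult_eq_mod)
    then have "bform u y mod int d = 0" using uv xy Pd by (intro zero[of u "y + _ \<cdot>\<^sub>v v"]) auto
    then show "int d dvd bform u y" by (simp add: dvd_eq_mod_eq_0)
    have "bform (x + (- (bform x v div int d)) \<cdot>\<^sub>v u) v = bform x v mod int d"
      using uv xy by (simp add: bform_left minus_div_mult_eq_mod)
    then have "bform x v mod int d = 0" using uv xy Pd by (intro zero[of "x + _ \<cdot>\<^sub>v u" v]) auto
    then show "int d dvd bform x v" by (simp add: dvd_eq_mod_eq_0)
  qed
  obtain u v where uv: "u \<in> carrier_vec m" "v \<in> carrier_vec n" "bform u v = int d" using Pd by blast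
  have "int d dvd bform x y" if xy: "x \<in> carrier_vec m" "y \<in> carrier_vec n" for x y
  proof -
    obtain s t where s: "bform x v = int d * s" and t: "bform u y = int d * t"
      using step[OF uv xy] by (auto elim!: dvdE)
    define x' where "x' = x + (- s) \<cdot>\<^sub>v u"
    define y' where "y' = y + (- t) \<cdot>\<^sub>v v"
    have x': "x' \<in> carrier_vec m" "u + 1 \<cdot>\<^sub>v x' \<in> carrier_vec m" and y': "y' \<in> carrier_vec n"
      using xy uv by (auto simp: x'_def y'_def)
    have xv: "bform x' v = 0" and uy: "bform u y' = 0"
      using xy uv s t by (simp_all add: x'_def y'_def bform_left bform_right)
    have "bform (u + 1 \<cdot>\<^sub>v x') v = int d" using uv x' xv by (subst bform_left) auto
    from step[OF x'(2) uv(2) this uv(1) y'] have "int d dvd bform (u + 1 \<cdot>\<^sub>v x') y'" by blast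
    then have "int d dvd bform x' y'" using uv x' y' uy by (subst (asm) bform_left) auto
    moreover have "bform x' y' = bform x y - int d * s * t"
      using xy uv s t y' by (simp add: x'_def bform_left y'_def bform_right algebra_simps)
    ultimately show ?thesis by (metis diff_add_cancel dvd_add dvd_mult2 dvd_triv_left)
  qed
  then show ?thesis using that[of "int d" u v] uv Pd by auto
qed

section \<open>Diagonal systems of vectors\<close>

definition diagonal_system :: "nat \<Rightarrow> (nat \<Rightarrow> int) \<Rightarrow> (nat \<Rightarrow> int vec) \<Rightarrow> (nat \<Rightarrow> int vec) \<Rightarrow> bool" where
  "diagonal_system k e u v \<longleftrightarrow> (\<forall>i<k. u i \<in> carrier_vec m \<and> v i \<in> carrier_vec n \<and> e i \<noteq> 0) \<and>
    (\<forall>i<k. \<forall>j<k. bform (u i) (v j) = (if i = j then e i else 0))"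

text \<open>A relation among the \<open>u i\<close> with \<open>c i \<noteq> 0\<close>, paired with
  \<open>v i\<close>, would give \<open>c i * e i = 0\<close>. The bound ensures that a maximal
  \<open>k\<close> exists.\<close>

lemma diagonal_system_le:
  assumes "diagonal_system k e u v" shows "k \<le> m"
proof (rule ccontr)
  assume "\<not> k \<le> m"
  then obtain c i where c: "i < k" "c i \<noteq> 0" "\<And>t. t < m \<Longrightarrow> (\<Sum>i<k. c i * (u i $ t)) = 0"
    using exists_integer_relation[of "{..<k}" m "\<lambda>i t. u i $ t"] by auto
  have car: "u j \<in> carrier_vec m" if "j < k" for j using assms that unfolding diagonal_system_def by blast
  have vi: "v i \<in> carrier_vec n" "e i \<noteq> 0" using assms c(1) unfolding diagonal_system_def by blast+
  define w where "w = B *\<^sub>v v i"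
  have w: "dim_vec w = m" using B vi by (simp add: w_def)
  have "(\<Sum>j<k. c j * bform (u j) (v i)) = (\<Sum>j<k. \<Sum>t<m. c j * (u j $ t) * w $ t)"
    unfolding bform_def w_def[symmetric] scalar_prod_def w
    by (simp add: sum_distrib_left lessThan_atLeast0 mult.assoc)
  also have "\<dots> = (\<Sum>t<m. (\<Sum>j<k. c j * (u j $ t)) * w $ t)"
    by (subst sum.swap) (simp add: sum_distrib_right)
  also have "\<dots> = 0" using c(3) by simp
  finally have "(\<Sum>j<k. c j * bform (u j) (v i)) = 0" .
  moreover have "(\<Sum>j<k. c j * bform (u j) (v i)) = (\<Sum>j<k. if j = i then c i * e i else 0)"
    using assms c(1) unfolding diagonal_system_def by (intro sum.cong) auto
  ultimately show False using c(1,2) vi by simp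
qed

text \<open>Gram-Schmidt: a violation of the product formula extends the diagonal system.\<close>

lemma diagonal_system_Suc:
  assumes s: "diagonal_system k e u v" and k: "0 < k"
    and xy: "x \<in> carrier_vec m" "y \<in> carrier_vec n"
    and orth: "\<And>l. 0 < l \<Longrightarrow> l < k \<Longrightarrow> bform x (v l) = 0 \<and> bform (u l) y = 0"
    and ne: "e 0 * bform x y \<noteq> bform x (v 0) * bform (u 0) y"
  shows "\<exists>e' u' v'. e' 0 = e 0 \<and> diagonal_system (Suc k) e' u' v'"
proof -
  define x' where "x' = e 0 \<cdot>\<^sub>v x + (- bform x (v 0)) \<cdot>\<^sub>v u 0"
  define y' where "y' = e 0 \<cdot>\<^sub>v y + (- bform (u 0) y) \<cdot>\<^sub>v v 0"
  have c: "u i \<in> carrier_vec m" "v i \<in> carrier_vec n" "e i \<noteq> 0" if "i < k" for i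
    using s that unfolding diagonal_system_def by blast+
  have g: "bform (u i) (v j) = (if i = j then e i else 0)" if "i < k" "j < k" for i j
    using s that unfolding diagonal_system_def by blast
  have x': "x' \<in> carrier_vec m" and y': "y' \<in> carrier_vec n" using xy c[OF k] by (auto simp: x'_def y'_def)
  have xv: "bform x' (v l) = 0" if "l < k" for l
    using xy c[OF k] c[OF that] g[OF k that] orth[of l] that unfolding x'_def
    by (cases "l = 0") (simp_all add: bform_left bform_smult)
  have uy: "bform (u l) y' = 0" if "l < k" for l
    using xy c[OF k] c[OF that] g[OF that k] orth[of l] that unfolding y'_def
    by (cases "l = 0") (simp_all add: bform_right bform_smult)
  have "bform x' y' = e 0 * bform x y'"
    using xy c[OF k] y' uy[OF k] unfolding x'_def by (simp add: bform_left bform_smult)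
  also have "bform x y' = e 0 * bform x y - bform x (v 0) * bform (u 0) y"
    using xy c[OF k] unfolding y'_def by (simp add: bform_right bform_smult mult.commute)
  finally have "bform x' y' \<noteq> 0" using ne c(3)[OF k] by simp
  then have "diagonal_system (Suc k) (e(k := bform x' y')) (u(k := x')) (v(k := y'))"
    unfolding diagonal_system_def using c g x' y' xv uy by (auto simp: less_Suc_eq)
  then show ?thesis using k by (intro exI[of _ "e(k := bform x' y')"] exI conjI) simp_all
qed

text \<open>The product formula covers every diagonal system with this \<open>k\<close> and
  \<open>e\<close>, as the vectors in a solution of the equations need not be those found here.
  Extensions keep \<open>e 0\<close>, so \<open>k\<close> is maximal among the systems whose first
  entry is the least positive value.\<close>

lemma maximal_diagonal_system:
  assumes "B \<noteq> 0\<^sub>m m n"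
  obtains k e u v where "0 < k" "diagonal_system k e u v" "e 0 > 0"
    "\<And>x y. x \<in> carrier_vec m \<Longrightarrow> y \<in> carrier_vec n \<Longrightarrow> e 0 dvd bform x y"
    "\<And>u v x y. diagonal_system k e u v \<Longrightarrow> x \<in> carrier_vec m \<Longrightarrow> y \<in> carrier_vec n \<Longrightarrow>
      (\<And>l. 0 < l \<Longrightarrow> l < k \<Longrightarrow> bform x (v l) = 0 \<and> bform (u l) y = 0) \<Longrightarrow>
      e 0 * bform x y = bform x (v 0) * bform (u 0) y"
proof -
  obtain d u v where d: "d > 0" "u \<in> carrier_vec m" "v \<in> carrier_vec n" "bform u v = d"
    "\<And>x y. x \<in> carrier_vec m \<Longrightarrow> y \<in> carrier_vec n \<Longrightarrow> d dvd bform x y"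
    using minimal_value[OF assms] by blast
  let ?P = "\<lambda>k. 0 < k \<and> (\<exists>e u v. e 0 = d \<and> diagonal_system k e u v)"
  have "diagonal_system 1 (\<lambda>_. d) (\<lambda>_. u) (\<lambda>_. v)"
    using d unfolding diagonal_system_def by simp
  then have P1: "?P 1" by (intro conjI exI[of _ "\<lambda>_. d"] exI) (simp, rule refl)
  have bound: "k \<le> m" if "?P k" for k using that diagonal_system_le by blast
  define k where "k = (GREATEST k. ?P k)"
  have Pk: "?P k" unfolding k_def by (rule GreatestI_nat[where P = ?P and b = m, OF P1 bound])
  have max: "\<not> ?P (Suc k)"
  proof
    assume "?P (Suc k)"
    then have "Suc k \<le> k" unfolding k_def by (rule Greatest_le_nat[where P = ?P and b = m]) (rule bound)
    then show False by simp
  qed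
  obtain e u v where k: "0 < k" "e 0 = d" "diagonal_system k e u v" using Pk by blast
  have key: "e 0 * bform x y = bform x (v 0) * bform (u 0) y"
    if "diagonal_system k e u v" "x \<in> carrier_vec m" "y \<in> carrier_vec n"
      "\<And>l. 0 < l \<Longrightarrow> l < k \<Longrightarrow> bform x (v l) = 0 \<and> bform (u l) y = 0" for u v x y
  proof (rule ccontr)
    assume "e 0 * bform x y \<noteq> bform x (v 0) * bform (u 0) y"
    then have "?P (Suc k)" using diagonal_system_Suc[OF that(1) k(1) that(2-4)] k(2) by auto
    then show False using max by blast
  qed
  show ?thesis
  proof (rule that[OF k(1,3)])
    show "e 0 > 0" "\<And>x y. x \<in> carrier_vec m \<Longrightarrow> y \<in> carrier_vec n \<Longrightarrow> e 0 dvd bform x y"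
      using d(1,5) k(2) by auto
  qed (rule key)
qed

end

section \<open>Bilinear systems\<close>

type_synonym equation = "(nat \<times> nat \<times> int) list \<times> int"

definition lhs :: "(nat \<times> nat \<times> int) list \<Rightarrow> (nat \<Rightarrow> nat \<Rightarrow> int) \<Rightarrow> int" where
  "lhs L M = (\<Sum>(i, j, c)\<leftarrow>L. c * M i j)"

text \<open>Entries with the same indices add up, since an atom such as \<open>Plus_Eq x x z\<close>
  lists a pair twice.\<close>

definition coeff_of :: "(nat \<times> nat \<times> int) list \<Rightarrow> nat \<Rightarrow> nat \<Rightarrow> int" where
  "coeff_of L i j = (\<Sum>(i', j', c)\<leftarrow>L. if i' = i \<and> j' = j then c else 0)"

lemma sum_coeff_of:
  assumes "\<forall>(i, j, c)\<in>set L. i < r \<and> j < r"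
  shows "(\<Sum>i<r. \<Sum>j<r. coeff_of L i j * M i j) = lhs L M"
  using assms
proof (induction L)
  case (Cons t L)
  obtain p q c where t: "t = (p, q, c)" by (cases t)
  have "(\<Sum>i<r. \<Sum>j<r. coeff_of (t # L) i j * M i j) =
      (\<Sum>i<r. \<Sum>j<r. (if p = i \<and> q = j then c else 0) * M i j) + (\<Sum>i<r. \<Sum>j<r. coeff_of L i j * M i j)"
    unfolding t by (simp add: coeff_of_def distrib_right sum.distrib)
  also have "(\<Sum>i<r. \<Sum>j<r. (if p = i \<and> q = j then c else 0) * M i j) = (\<Sum>i<r. if p = i then c * M p q else 0)"
  proof (rule sum.cong)
    show "(\<Sum>j<r. (if p = i \<and> q = j then c else 0) * M i j) = (if p = i then c * M p q else 0)" for i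
    proof (cases "p = i")
      case True
      have "(\<Sum>j<r. (if p = i \<and> q = j then c else 0) * M i j) = (\<Sum>j<r. if q = j then c * M p q else 0)"
        using True by (intro sum.cong) auto
      then show ?thesis using True Cons.prems t by simp
    qed simp
  qed simp
  also have "\<dots> = c * M p q" using Cons.prems t by simp
  finally show ?case using Cons t by (simp add: lhs_def)
qed (simp add: coeff_of_def lhs_def)

lemma system_solvable_equations:
  assumes "B \<in> carrier_mat m n"
    and "\<And>L b i j c. (L, b) \<in> set E \<Longrightarrow> (i, j, c) \<in> set L \<Longrightarrow> i < r \<and> j < r"
  shows "system_solvable m n B r (length E) (\<lambda>q. coeff_of (fst (E ! q))) (\<lambda>q. snd (E ! q)) \<longleftrightarrow>
    (\<exists>u v. (\<forall>i<r. u i \<in> carrier_vec m) \<and> (\<forall>j<r. v j \<in> carrier_vec n) \<and>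
      (\<forall>(L, b)\<in>set E. lhs L (\<lambda>i j. bform B (u i) (v j)) = b))"
proof -
  have "(\<Sum>i<r. \<Sum>j<r. coeff_of (fst (E ! q)) i j * (u i \<bullet> (B *\<^sub>v v j))) =
      lhs (fst (E ! q)) (\<lambda>i j. bform B (u i) (v j))" if "q < length E" for q u v
  proof -
    have "(fst (E ! q), snd (E ! q)) \<in> set E" using that by simp
    then have "\<forall>(i, j, c)\<in>set (fst (E ! q)). i < r \<and> j < r" using assms(2) by blast
    then show ?thesis using sum_coeff_of[of _ r "\<lambda>i j. bform B (u i) (v j)"]
      by (simp add: bform_def[OF assms(1)])
  qed
  then show ?thesis unfolding system_solvable_def all_set_conv_all_nth[of E] case_prod_beta by simp
qed

text \<open>Variable \<open>x\<close> of the atoms occupies the five indices from \<open>k + 5 * x\<close> on: the first one holds its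
  value, the others the integers whose squares sum up to it.\<close>

fun atom_equation :: "nat \<Rightarrow> int \<Rightarrow> nat atom \<Rightarrow> equation" where
  "atom_equation k d (Const_Eq x c) = ([(k + 5 * x, 0, 1)], d * int c)"
| "atom_equation k d (Plus_Eq x y z) = ([(k + 5 * x, 0, 1), (k + 5 * y, 0, 1), (k + 5 * z, 0, -1)], 0)"
| "atom_equation k d (Times_Eq x y z) = ([(k + 5 * x, k + 5 * y, 1), (k + 5 * z, 0, -1)], 0)"

text \<open>The equations with coefficients 1 and -1 for \<open>(k + i, 0)\<close> and
  \<open>(0, k + i)\<close> make the two vectors of index \<open>k + i\<close> carry the same
  integer. In the last family the diagonal entries stand for \<open>e 0\<close> times squares of
  such integers.\<close>

definition structure_equations :: "nat \<Rightarrow> (nat \<Rightarrow> int) \<Rightarrow> nat \<Rightarrow> equation list" where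
  "structure_equations k e V =
    [([(i, j, 1)], if i = j then e i else 0). i \<leftarrow> [0..<k], j \<leftarrow> [0..<k]] @
    [([(k + i, l, 1)], 0). i \<leftarrow> [0..<5 * V], l \<leftarrow> [1..<k]] @
    [([(l, k + i, 1)], 0). i \<leftarrow> [0..<5 * V], l \<leftarrow> [1..<k]] @
    [([(k + i, 0, 1), (0, k + i, -1)], 0). i \<leftarrow> [0..<5 * V]] @
    [([(k + 5 * x, 0, 1), (k + 5 * x + 1, k + 5 * x + 1, -1), (k + 5 * x + 2, k + 5 * x + 2, -1),
       (k + 5 * x + 3, k + 5 * x + 3, -1), (k + 5 * x + 4, k + 5 * x + 4, -1)], 0). x \<leftarrow> [0..<V]]"

lemma structure_equations_iff:
  "(\<forall>(L, b)\<in>set (structure_equations k e V). lhs L M = b) \<longleftrightarrow>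
    (\<forall>i<k. \<forall>j<k. M i j = (if i = j then e i else 0)) \<and>
    (\<forall>i<5 * V. \<forall>l. 0 < l \<longrightarrow> l < k \<longrightarrow> M (k + i) l = 0 \<and> M l (k + i) = 0) \<and>
    (\<forall>i<5 * V. M (k + i) 0 = M 0 (k + i)) \<and>
    (\<forall>x<V. M (k + 5 * x) 0 = M (k + (5 * x + 1)) (k + (5 * x + 1)) + M (k + (5 * x + 2)) (k + (5 * x + 2)) +
      M (k + (5 * x + 3)) (k + (5 * x + 3)) + M (k + (5 * x + 4)) (k + (5 * x + 4)))"
proof -
  let ?sat = "\<lambda>E. \<forall>(L, b)\<in>set E. lhs L M = b"
  have app: "?sat (E @ E') \<longleftrightarrow> ?sat E \<and> ?sat E'" for E E' by (simp only: set_append ball_Un)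
  have 1: "?sat [([(i, j, 1)], if i = j then e i else 0). i \<leftarrow> [0..<k], j \<leftarrow> [0..<k]] \<longleftrightarrow>
      (\<forall>i<k. \<forall>j<k. M i j = (if i = j then e i else 0))"
    by (auto simp: lhs_def)
  have 2: "?sat [([(k + i, l, 1)], 0). i \<leftarrow> [0..<5 * V], l \<leftarrow> [1..<k]] \<longleftrightarrow>
      (\<forall>i<5 * V. \<forall>l. 0 < l \<longrightarrow> l < k \<longrightarrow> M (k + i) l = 0)"
    by (auto simp: lhs_def Suc_le_eq)
  have 3: "?sat [([(l, k + i, 1)], 0). i \<leftarrow> [0..<5 * V], l \<leftarrow> [1..<k]] \<longleftrightarrow>
      (\<forall>i<5 * V. \<forall>l. 0 < l \<longrightarrow> l < k \<longrightarrow> M l (k + i) = 0)"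
    by (auto simp: lhs_def Suc_le_eq)
  have 4: "?sat [([(k + i, 0, 1), (0, k + i, -1)], 0). i \<leftarrow> [0..<5 * V]] \<longleftrightarrow>
      (\<forall>i<5 * V. M (k + i) 0 = M 0 (k + i))"
    by (auto simp: lhs_def)
  have 5: "?sat [([(k + 5 * x, 0, 1), (k + 5 * x + 1, k + 5 * x + 1, -1), (k + 5 * x + 2, k + 5 * x + 2, -1),
       (k + 5 * x + 3, k + 5 * x + 3, -1), (k + 5 * x + 4, k + 5 * x + 4, -1)], 0). x \<leftarrow> [0..<V]] \<longleftrightarrow>
      (\<forall>x<V. M (k + 5 * x) 0 = M (k + (5 * x + 1)) (k + (5 * x + 1)) + M (k + (5 * x + 2)) (k + (5 * x + 2)) +
      M (k + (5 * x + 3)) (k + (5 * x + 3)) + M (k + (5 * x + 4)) (k + (5 * x + 4)))"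
    by (auto simp: lhs_def add.assoc dest!: bspec)
  show ?thesis unfolding structure_equations_def app 1 2 3 4 5 by blast
qed

lemma structure_equations_bound:
  assumes "0 < k" "(L, b) \<in> set (structure_equations k e V)" "(i, j, c) \<in> set L"
  shows "i < k + 5 * V \<and> j < k + 5 * V"
  using assms unfolding structure_equations_def by auto

lemma atom_equation_bound:
  assumes "0 < k" "\<And>x. x \<in> set_atom A \<Longrightarrow> x < V" "atom_equation k d A = (L, b)" "(i, j, c) \<in> set L"
  shows "i < k + 5 * V \<and> j < k + 5 * V"
  using assms by (cases A) fastforce+

text \<open>For a maximal diagonal system the structure equations force
  \<open>e 0 * M (k + i) (k + j) = M (k + i) 0 * M 0 (k + j)\<close>, while \<open>e 0\<close> divides all entries; hence
  \<open>M (k + i) (k + j)\<close> is \<open>e 0\<close> times the product of the integers \<open>M (k + i) 0 / e 0\<close> and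
  \<open>M (k + j) 0 / e 0\<close>.\<close>

lemma equations_solvable_iff:
  assumes B: "B \<in> carrier_mat m n" and "B \<noteq> 0\<^sub>m m n"
  shows "\<exists>k e. 0 < k \<and> 0 < e 0 \<and> (\<forall>V S. (\<forall>A\<in>set S. \<forall>x\<in>set_atom A. x < V) \<longrightarrow>
      ((\<exists>u v. (\<forall>i<k + 5 * V. u i \<in> carrier_vec m) \<and> (\<forall>j<k + 5 * V. v j \<in> carrier_vec n) \<and>
        (\<forall>(L, b)\<in>set (map (atom_equation k (e 0)) S @ structure_equations k e V).
          lhs L (\<lambda>i j. bform B (u i) (v j)) = b)) \<longleftrightarrow>
      (\<exists>w. \<forall>A\<in>set S. sat w A)))"
proof -
  obtain k e u0 v0 where k: "0 < k" and sys: "diagonal_system B m n k e u0 v0" and e0: "e 0 > 0"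
    and dvd: "\<And>x y. x \<in> carrier_vec m \<Longrightarrow> y \<in> carrier_vec n \<Longrightarrow> e 0 dvd bform B x y"
    and max: "\<And>u v x y. diagonal_system B m n k e u v \<Longrightarrow> x \<in> carrier_vec m \<Longrightarrow> y \<in> carrier_vec n \<Longrightarrow>
      (\<And>l. 0 < l \<Longrightarrow> l < k \<Longrightarrow> bform B x (v l) = 0 \<and> bform B (u l) y = 0) \<Longrightarrow>
      e 0 * bform B x y = bform B x (v 0) * bform B (u 0) y"
    using maximal_diagonal_system[OF assms] by blast
  note ds = diagonal_system_def[OF B]
  have ne: "e i \<noteq> 0" if "i < k" for i using sys that unfolding ds by blast
  show ?thesis
  proof (intro exI[of _ k] exI[of _ e] conjI allI impI k e0)
    fix V and S :: "nat atom list"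
    assume V': "\<forall>A\<in>set S. \<forall>x\<in>set_atom A. x < V"
    have V: "x < V" if "A \<in> set S" "x \<in> set_atom A" for A x using V' that by blast
    have split: "(\<forall>(L, b)\<in>set (map (atom_equation k (e 0)) S @ structure_equations k e V). lhs L M = b) \<longleftrightarrow>
      (\<forall>A\<in>set S. case atom_equation k (e 0) A of (L, b) \<Rightarrow> lhs L M = b) \<and>
      (\<forall>(L, b)\<in>set (structure_equations k e V). lhs L M = b)" for M
      by (simp only: set_append ball_Un set_map ball_simps)
    show "(\<exists>u v. (\<forall>i<k + 5 * V. u i \<in> carrier_vec m) \<and> (\<forall>j<k + 5 * V. v j \<in> carrier_vec n) \<and>
        (\<forall>(L, b)\<in>set (map (atom_equation k (e 0)) S @ structure_equations k e V).
          lhs L (\<lambda>i j. bform B (u i) (v j)) = b)) \<longleftrightarrow> (\<exists>w. \<forall>A\<in>set S. sat w A)" (is "?L \<longleftrightarrow> ?R")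
    proof
      assume ?L
      then obtain u v where u: "\<And>i. i < k + 5 * V \<Longrightarrow> u i \<in> carrier_vec m"
        and v: "\<And>i. i < k + 5 * V \<Longrightarrow> v i \<in> carrier_vec n"
        and eqs: "\<forall>(L, b)\<in>set (map (atom_equation k (e 0)) S @ structure_equations k e V).
          lhs L (\<lambda>i j. bform B (u i) (v j)) = b" by blast
      define M where "M i j = bform B (u i) (v j)" for i j
      have conds: "(\<forall>A\<in>set S. case atom_equation k (e 0) A of (L, b) \<Rightarrow> lhs L M = b) \<and>
          (\<forall>(L, b)\<in>set (structure_equations k e V). lhs L M = b)"
        using eqs unfolding split M_def[abs_def] .
      note struct = conds[THEN conjunct2, unfolded structure_equations_iff]
      have atoms: "\<And>A. A \<in> set S \<Longrightarrow> case atom_equation k (e 0) A of (L, b) \<Rightarrow> lhs L M = b"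
        by (rule conds[THEN conjunct1, THEN bspec])
      have gram: "\<And>i j. i < k \<Longrightarrow> j < k \<Longrightarrow> M i j = (if i = j then e i else 0)"
        and orth: "\<And>i l. i < 5 * V \<Longrightarrow> 0 < l \<Longrightarrow> l < k \<Longrightarrow> M (k + i) l = 0 \<and> M l (k + i) = 0"
        and sym: "\<And>i. i < 5 * V \<Longrightarrow> M (k + i) 0 = M 0 (k + i)"
        using struct by simp_all
      have sq: "\<And>x. x < V \<Longrightarrow> M (k + 5 * x) 0 = M (k + (5 * x + 1)) (k + (5 * x + 1)) +
          M (k + (5 * x + 2)) (k + (5 * x + 2)) + M (k + (5 * x + 3)) (k + (5 * x + 3)) +
          M (k + (5 * x + 4)) (k + (5 * x + 4))"
        using struct by blast
      \<comment> \<open>The first \<open>k\<close> vectors of any solution form a diagonal system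
        with the prescribed entries, so maximality applies to them.\<close>
      have sys': "diagonal_system B m n k e u v" unfolding ds using u v ne gram by (simp add: M_def)
      define z where "z i = M (k + i) 0 div e 0" for i
      have z: "M (k + i) 0 = e 0 * z i" if "i < 5 * V" for i
        using dvd[of "u (k + i)" "v 0"] u v k that unfolding z_def M_def by simp
      have zz: "M (k + i) (k + j) = e 0 * (z i * z j)" if "i < 5 * V" "j < 5 * V" for i j
      proof -
        have "e 0 * M (k + i) (k + j) = M (k + i) 0 * M 0 (k + j)" unfolding M_def
          by (rule max[OF sys']) (use u v orth that in \<open>auto simp: M_def\<close>)
        also have "\<dots> = e 0 * (e 0 * (z i * z j))" using sym[OF that(2)] z that by simp
        finally show ?thesis using e0 by simp
      qed
      have zsq: "z (5 * x) = (z (5 * x + 1))\<^sup>2 + (z (5 * x + 2))\<^sup>2 + (z (5 * x + 3))\<^sup>2 + (z (5 * x + 4))\<^sup>2"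
        if "x < V" for x
      proof -
        have "e 0 * z (5 * x) = e 0 * ((z (5 * x + 1))\<^sup>2 + (z (5 * x + 2))\<^sup>2 + (z (5 * x + 3))\<^sup>2 + (z (5 * x + 4))\<^sup>2)"
          using sq[OF that] that by (simp only: z zz distrib_left power2_eq_square)
        then show ?thesis using e0 by simp
      qed
      define w where "w x = nat (z (5 * x))" for x
      have w: "int (w x) = z (5 * x)" if "x < V" for x
        unfolding w_def using zsq[OF that] by simp
      have "sat w A" if A: "A \<in> set S" for A
      proof (cases A)
        case (Const_Eq x c)
        then have "x < V" using V[OF A] by simp
        then have "e 0 * int (w x) = e 0 * int c" using atoms[OF A] Const_Eq z[of "5 * x"] w by (simp add: lhs_def)
        then show ?thesis using Const_Eq e0 by simp
      next
        case (Plus_Eq x y t)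
        then have "x < V" "y < V" "t < V" using V[OF A] by simp_all
        then have "e 0 * (int (w x) + int (w y)) = e 0 * int (w t)"
          using atoms[OF A] Plus_Eq z[of "5 * x"] z[of "5 * y"] z[of "5 * t"] w by (simp add: lhs_def distrib_left)
        then have "int (w x + w y) = int (w t)" using e0 by simp
        then show ?thesis unfolding Plus_Eq sat.simps of_nat_eq_iff .
      next
        case (Times_Eq x y t)
        then have "x < V" "y < V" "t < V" using V[OF A] by simp_all
        then have "e 0 * (int (w x) * int (w y)) = e 0 * int (w t)"
          using atoms[OF A] Times_Eq zz[of "5 * x" "5 * y"] z[of "5 * t"] w by (simp add: lhs_def)
        then have "int (w x * w y) = int (w t)" using e0 by simp
        then show ?thesis unfolding Times_Eq sat.simps of_nat_eq_iff .
      qed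
      then show ?R by blast
    next
      assume ?R
      then obtain w where w: "\<And>A. A \<in> set S \<Longrightarrow> sat w A" by blast
      have "\<forall>x. \<exists>a b c d. int (w x) = a\<^sup>2 + b\<^sup>2 + c\<^sup>2 + d\<^sup>2" using four_squares unfolding sum4_def by blast
      then obtain a b c d where abcd: "\<And>x. int (w x) = (a x)\<^sup>2 + (b x)\<^sup>2 + (c x)\<^sup>2 + (d x)\<^sup>2" by metis
      define z where "z i = [int (w (i div 5)), a (i div 5), b (i div 5), c (i div 5), d (i div 5)] ! (i mod 5)" for i
      have zj: "z (5 * x + j) = [int (w x), a x, b x, c x, d x] ! j" if "j < 5" for j x
      proof -
        have "(5 * x + j) div 5 = x" "(5 * x + j) mod 5 = j" using that by presburger+
        then show ?thesis by (simp only: z_def)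
      qed
      have z: "z (5 * x) = int (w x)" "z (5 * x + 1) = a x" "z (5 * x + 2) = b x" "z (5 * x + 3) = c x"
        "z (5 * x + 4) = d x" for x
        using zj[of 0 x] zj[of 1 x] zj[of 2 x] zj[of 3 x] zj[of 4 x] by simp_all
      \<comment> \<open>From index \<open>k\<close> on, only multiples of the first pair are used;
        they are orthogonal to the other pairs and multiply like their integer factors.\<close>
      define u v where "u i = (if i < k then u0 i else z (i - k) \<cdot>\<^sub>v u0 0)"
        and "v i = (if i < k then v0 i else z (i - k) \<cdot>\<^sub>v v0 0)" for i
      have c0: "\<And>i. i < k \<Longrightarrow> u0 i \<in> carrier_vec m" "\<And>i. i < k \<Longrightarrow> v0 i \<in> carrier_vec n"
        and g0: "\<And>i j. i < k \<Longrightarrow> j < k \<Longrightarrow> bform B (u0 i) (v0 j) = (if i = j then e i else 0)"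
        using sys unfolding ds by blast+
      define M where "M i j = bform B (u i) (v j)" for i j
      note smult = bform_smult[OF B]
      have gram: "M i j = (if i = j then e i else 0)" if "i < k" "j < k" for i j
        using that g0 by (simp add: M_def u_def v_def)
      have left: "M (k + i) l = (if l = 0 then e 0 * z i else 0)" if "l < k" for i l
        using that g0 k c0 by (simp add: M_def u_def v_def smult)
      have right: "M l (k + i) = (if l = 0 then e 0 * z i else 0)" if "l < k" for i l
        using that g0 k c0 by (simp add: M_def u_def v_def smult)
      have zz: "M (k + i) (k + j) = e 0 * (z i * z j)" for i j
        using g0 k c0 by (simp add: M_def u_def v_def smult)
      have atoms: "case atom_equation k (e 0) A of (L, b) \<Rightarrow> lhs L M = b" if A: "A \<in> set S" for A
      proof (cases A)
        case (Const_Eq x c)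
        then show ?thesis using w[OF A] k by (simp add: lhs_def left z)
      next
        case (Plus_Eq x y t)
        then have "int (w x) + int (w y) = int (w t)" using w[OF A] by (simp flip: of_nat_add)
        then have "e 0 * int (w x) + e 0 * int (w y) = e 0 * int (w t)" by (metis distrib_left)
        then show ?thesis using Plus_Eq k by (simp add: lhs_def left z)
      next
        case (Times_Eq x y t)
        then have "int (w x) * int (w y) = int (w t)" using w[OF A] by (simp flip: of_nat_mult)
        then show ?thesis using Times_Eq k by (simp add: lhs_def left zz z)
      qed
      have struct: "\<forall>(L, b)\<in>set (structure_equations k e V). lhs L M = b"
      proof -
        have "M (k + 5 * x) 0 = M (k + (5 * x + 1)) (k + (5 * x + 1)) + M (k + (5 * x + 2)) (k + (5 * x + 2)) +
          M (k + (5 * x + 3)) (k + (5 * x + 3)) + M (k + (5 * x + 4)) (k + (5 * x + 4))" for x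
          unfolding zz z left[OF k] by (simp add: abcd power2_eq_square distrib_left)
        moreover have "\<forall>i<k. \<forall>j<k. M i j = (if i = j then e i else 0)" using gram by blast
        moreover have "\<forall>i<5 * V. \<forall>l. 0 < l \<longrightarrow> l < k \<longrightarrow> M (k + i) l = 0 \<and> M l (k + i) = 0"
          using left right by simp
        moreover have "\<forall>i<5 * V. M (k + i) 0 = M 0 (k + i)" using left[OF k] right[OF k] by simp
        ultimately show ?thesis unfolding structure_equations_iff by blast
      qed
      have "\<forall>(L, b)\<in>set (map (atom_equation k (e 0)) S @ structure_equations k e V). lhs L M = b"
        unfolding split by (rule conjI[OF ballI[OF atoms] struct])
      moreover have "u i \<in> carrier_vec m" "v i \<in> carrier_vec n" for i
        using c0 k by (auto simp: u_def v_def)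
      ultimately show ?L unfolding M_def by blast
    qed
  qed
qed

section \<open>Undecidability\<close>

definition rf_add :: recf where
  "rf_add = PrimRec (Proj 0) (Comp Succ [Proj 1])"

definition rf_triangle :: recf where
  "rf_triangle = PrimRec Zero (Comp Succ [Comp rf_add [Proj 0, Proj 1]])"

text \<open>\<open>list_encode (x # ys)\<close> is the successor of
  \<open>prod_encode (x, list_encode ys)\<close>, and \<open>prod_encode (x, y)\<close> is
  \<open>triangle (x + y) + x\<close>.\<close>

definition rf_cons :: "recf \<Rightarrow> recf \<Rightarrow> recf" where
  "rf_cons f g = Comp (Comp Succ [Comp rf_add [Comp rf_triangle [rf_add], Proj 0]]) [f, g]"

primrec rf_scale :: "nat \<Rightarrow> recf \<Rightarrow> recf" where
  "rf_scale 0 f = Zero"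
| "rf_scale (Suc c) f = Comp rf_add [f, rf_scale c f]"

lemma rec_eval_add: "rec_eval rf_add [x, y] = Some (x + y)"
  unfolding rf_add_def by (induction x) (simp_all add: Let_def)

lemma rec_eval_triangle: "rec_eval rf_triangle [x] = Some (triangle x)"
  unfolding rf_triangle_def
  by (induction x) (simp_all add: Let_def rec_eval_add)

lemma rec_eval_cons:
  assumes "rec_eval f xs = Some x" "rec_eval g xs = Some (list_encode ys)"
  shows "rec_eval (rf_cons f g) xs = Some (list_encode (x # ys))"
  using assms unfolding rf_cons_def
  by (simp add: Let_def rec_eval_add rec_eval_triangle prod_encode_def)

lemma rec_eval_scale:
  assumes "rec_eval f xs = Some x" shows "rec_eval (rf_scale c f) xs = Some (c * x)"
  using assms by (induction c) (simp_all add: Let_def rec_eval_add)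

text \<open>The arguments after the search variable of the enclosing \<open>Mu\<close> are \<open>r\<close>, \<open>s\<close>, the code of the
  coefficients and the code of the right-hand sides from the fifth on; the first four right-hand sides
  are \<open>d\<close> times these four numbers. The factor \<open>2\<close> comes from \<open>int_encode\<close>.\<close>

definition rf_code :: "nat \<Rightarrow> recf" where
  "rf_code d = rf_cons (Proj 1) (rf_cons (Proj 2) (rf_cons (Proj 3) (rf_cons
    (rf_cons (rf_scale (2 * d) (Proj 1)) (rf_cons (rf_scale (2 * d) (Proj 2))
      (rf_cons (rf_scale (2 * d) (Proj 3)) (rf_cons (rf_scale (2 * d) (Proj 4)) (Proj 4))))) Zero)))"

lemma int_encode_mult_nat: "int_encode (int d * int x) = 2 * d * x"
  by (simp add: int_encode_def sum_encode_def nat_mult_distrib)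

text \<open>The code of \<open>w\<close> serves both as a number and as the tail to which four
  right-hand sides are prepended, so it never has to be decoded.\<close>

lemma rec_eval_code:
  "rec_eval (rf_code d) [i, r, s, a, list_encode w] = Some (list_encode [r, s, a,
    list_encode (map (\<lambda>x. int_encode (int d * int x)) [r, s, a, list_encode w] @ w)])"
proof -
  let ?xs = "[i, r, s, a, list_encode w]"
  have p: "rec_eval (Proj 1) ?xs = Some r" "rec_eval (Proj 2) ?xs = Some s"
    "rec_eval (Proj 3) ?xs = Some a" "rec_eval (Proj 4) ?xs = Some (list_encode w)"
    by (simp_all add: eval_nat_numeral)
  have z: "rec_eval Zero ?xs = Some (list_encode [])" by simp
  show ?thesis unfolding rf_code_def int_encode_mult_nat list.map append.simps
    by (intro rec_eval_cons rec_eval_scale p z)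
qed

text \<open>\<open>sum_encode\<close> maps the free variable \<open>Inl i\<close> to
  \<open>2 * i\<close>. The arguments occur only as constants of the four leading atoms, hence later
  only in right-hand sides.\<close>

lemma dioph_domain_system:
  fixes h :: recf
  obtains S :: "nat atom list"
  where "\<And>r s a w. (\<exists>y. rec_eval h [r, s, a, w] = Some y) \<longleftrightarrow>
    (\<exists>z. \<forall>A\<in>set (map (\<lambda>i. Const_Eq (2 * i) ([r, s, a, w] ! i)) [0..<4] @ S). sat z A)"
proof -
  have "dioph (\<lambda>e. rec_eval h (map (\<lambda>h. h e) [\<lambda>e. e 1, \<lambda>e. e 2, \<lambda>e. e 3, \<lambda>e. e 4]) = Some (e 0))"
    by (rule dioph_rec_eval) (auto intro: dfun_var)
  then have "dioph (\<lambda>e. \<exists>y. rec_eval h [e 0, e 1, e 2, e 3] = Some y)"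
    by (intro dioph_ex) (simp add: eval_nat_numeral)
  then obtain S :: "(nat + nat) atom list" where
    S: "\<And>e. (\<exists>y. rec_eval h [e 0, e 1, e 2, e 3] = Some y) \<longleftrightarrow> (\<exists>h. \<forall>A\<in>set S. sat (case_sum e h) A)"
    unfolding dioph_def by blast
  have "(\<exists>y. rec_eval h [r, s, a, w] = Some y) \<longleftrightarrow>
    (\<exists>z. \<forall>A\<in>set (map (\<lambda>i. Const_Eq (2 * i) ([r, s, a, w] ! i)) [0..<4] @ map (map_atom sum_encode) S). sat z A)"
    (is "?L \<longleftrightarrow> (\<exists>z. ?P z)") for r s a w
  proof -
    have P: "?P z \<longleftrightarrow> z 0 = r \<and> z 2 = s \<and> z 4 = a \<and> z 6 = w \<and> (\<forall>A\<in>set S. sat (\<lambda>v. z (sum_encode v)) A)" for z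
      by (simp add: sat_map_atom upt_conv_Cons eval_nat_numeral ball_Un)
    show ?thesis
    proof
      assume ?L
      then obtain h where h: "\<forall>A\<in>set S. sat (case_sum (\<lambda>i. [r, s, a, w] ! i) h) A"
        using S[of "\<lambda>i. [r, s, a, w] ! i"] by (auto simp: eval_nat_numeral)
      have "sum_decode (2 * i) = Inl i" for i by (simp add: sum_decode_def)
      from this[of 0] this[of 1] this[of 2] this[of 3]
      have "?P (\<lambda>i. case_sum (\<lambda>i. [r, s, a, w] ! i) h (sum_decode i))"
        unfolding P using h by simp
      then show "\<exists>z. ?P z" by blast
    next
      assume "\<exists>z. ?P z"
      then obtain z where z: "z 0 = r" "z 2 = s" "z 4 = a" "z 6 = w" "\<forall>A\<in>set S. sat (\<lambda>v. z (sum_encode v)) A"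
        unfolding P by blast
      have "(\<lambda>v. z (sum_encode v)) = case_sum (\<lambda>i. z (2 * i)) (\<lambda>j. z (Suc (2 * j)))"
        by (auto simp: sum_encode_def split: sum.split)
      then show ?L using z S[of "\<lambda>i. z (2 * i)"] by auto
    qed
  qed
  then show ?thesis using that by blast
qed

theorem theorem7p9:
  fixes B :: "int mat" and m n :: nat
  assumes "B \<in> carrier_mat m n" and "B \<noteq> 0\<^sub>m m n"
  shows "\<not> (\<exists>f. \<forall>r s a c. r > 0 \<longrightarrow> s > 0 \<longrightarrow>
    rec_eval f [instance_code r s a c] = Some (if system_solvable m n B r s a c then 1 else 0))"
proof
  assume "\<exists>f. \<forall>r s a c. r > 0 \<longrightarrow> s > 0 \<longrightarrow>
    rec_eval f [instance_code r s a c] = Some (if system_solvable m n B r s a c then 1 else 0)"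
  then obtain f where f: "\<And>r s a c. r > 0 \<Longrightarrow> s > 0 \<Longrightarrow>
    rec_eval f [instance_code r s a c] = Some (if system_solvable m n B r s a c then 1 else 0)" by blast
  obtain k e where k: "0 < k" and e: "0 < e 0" and solv:
    "\<forall>V S. (\<forall>A\<in>set S. \<forall>x\<in>set_atom A. x < V) \<longrightarrow>
      ((\<exists>u v. (\<forall>i<k + 5 * V. u i \<in> carrier_vec m) \<and> (\<forall>j<k + 5 * V. v j \<in> carrier_vec n) \<and>
        (\<forall>(L, b)\<in>set (map (atom_equation k (e 0)) S @ structure_equations k e V).
          lhs L (\<lambda>i j. bform B (u i) (v j)) = b)) \<longleftrightarrow>
      (\<exists>w. \<forall>A\<in>set S. sat w A))"
    using equations_solvable_iff[OF assms] by (elim exE conjE) (rule that)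
  define d where "d = nat (e 0)"
  have d: "e 0 = int d" using e by (simp add: d_def)
  \<comment> \<open>The search variable is ignored by \<open>rf_code d\<close>: the search stops at
    once if \<open>f\<close> answers 0 and never stops if \<open>f\<close> answers 1.\<close>
  define h where "h = Mu (Comp f [rf_code d])"
  obtain S where S: "\<And>r s a w. (\<exists>y. rec_eval h [r, s, a, w] = Some y) \<longleftrightarrow>
    (\<exists>z. \<forall>A\<in>set (map (\<lambda>i. Const_Eq (2 * i) ([r, s, a, w] ! i)) [0..<4] @ S). sat z A)"
    using dioph_domain_system[of h] by blast
  \<comment> \<open>The argument variables are 0, 2, 4 and 6, whence the bound 7.\<close>
  obtain V where V: "7 \<le> V" "\<And>A x. A \<in> set S \<Longrightarrow> x \<in> set_atom A \<Longrightarrow> x < V"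
  proof -
    have "finite (\<Union>A\<in>set S. set_atom A)" by (simp add: atom.set_finite)
    then obtain N where N: "\<And>A x. A \<in> set S \<Longrightarrow> x \<in> set_atom A \<Longrightarrow> x \<le> N"
      by (auto simp: finite_nat_set_iff_bounded_le)
    show ?thesis
    proof (rule that[of "N + 7"])
      show "x < N + 7" if "A \<in> set S" "x \<in> set_atom A" for A x using N[OF that] by simp
    qed simp
  qed
  define E where "E = map (atom_equation k (int d)) S @ structure_equations k e V"
  define P where "P xs = map (\<lambda>i. atom_equation k (int d) (Const_Eq (2 * i) (xs ! i))) [0..<4]" for xs
  define r where "r = k + 5 * V"
  define s where "s = 4 + length E"
  \<comment> \<open>Left-hand sides in \<open>P\<close> do not depend on its argument, so zeros
    serve as placeholders and the coefficients are fixed before \<open>xs\<close> is formed.\<close>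
  define a where "a q = coeff_of (fst ((P [0, 0, 0, 0] @ E) ! q))" for q
  define acode where "acode = list_encode (map (\<lambda>q. list_encode (map (\<lambda>i. list_encode (map (\<lambda>j. int_encode (a q i j))
       [0..<r])) [0..<r])) [0..<s])"
  define w where "w = map (\<lambda>(L, b). int_encode b) E"
  define xs where "xs = [r, s, acode, list_encode w]"
  define c where "c q = snd ((P xs @ E) ! q)" for q
  have lenP: "length (P xs) = 4" for xs by (simp add: P_def)
  have fstP: "map fst (P xs) = map fst (P ys)" for xs ys by (simp add: P_def)
  have a: "a = (\<lambda>q. coeff_of (fst ((P xs @ E) ! q)))"
  proof
    fix q
    have "fst (P [0, 0, 0, 0] ! q) = fst (P xs ! q)" if "q < 4"
      using fstP[of "[0, 0, 0, 0]" xs] that lenP by (metis nth_map)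
    then show "a q = coeff_of (fst ((P xs @ E) ! q))"
      unfolding a_def by (simp add: nth_append lenP)
  qed
  have s: "s = length (P xs @ E)" by (simp add: s_def lenP)
  have PE: "P xs @ E = map (atom_equation k (e 0)) (map (\<lambda>i. Const_Eq (2 * i) (xs ! i)) [0..<4] @ S) @
      structure_equations k e V"
    by (simp add: P_def E_def d)
  have vars: "x < V" if "A \<in> set (map (\<lambda>i. Const_Eq (2 * i) (xs ! i)) [0..<4] @ S)" "x \<in> set_atom A" for A x
    using that V by auto
  have "system_solvable m n B r s a c \<longleftrightarrow>
    (\<exists>u v. (\<forall>i<r. u i \<in> carrier_vec m) \<and> (\<forall>j<r. v j \<in> carrier_vec n) \<and>
      (\<forall>(L, b)\<in>set (P xs @ E). lhs L (\<lambda>i j. bform B (u i) (v j)) = b))"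
    unfolding a c_def s
  proof (rule system_solvable_equations[OF assms(1)])
    fix L b i j t assume L: "(L, b) \<in> set (P xs @ E)" "(i, j, t) \<in> set L"
    show "i < r \<and> j < r"
    proof (cases "(L, b) \<in> set (structure_equations k e V)")
      case True
      then show ?thesis unfolding r_def using structure_equations_bound[OF k _ L(2)] by blast
    next
      case False
      then obtain A where A: "A \<in> set (map (\<lambda>i. Const_Eq (2 * i) (xs ! i)) [0..<4] @ S)"
        "atom_equation k (e 0) A = (L, b)" using L(1) unfolding PE by fastforce
      show ?thesis unfolding r_def using atom_equation_bound[OF k vars[OF A(1)] A(2) L(2)] .
    qed
  qed
  also have "\<dots> \<longleftrightarrow> (\<exists>z. \<forall>A\<in>set (map (\<lambda>i. Const_Eq (2 * i) (xs ! i)) [0..<4] @ S). sat z A)"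
    unfolding PE r_def by (rule solv[rule_format]) (rule vars)
  also have "\<dots> \<longleftrightarrow> (\<exists>y. rec_eval h xs = Some y)" unfolding xs_def S ..
  finally have solvable_iff: "system_solvable m n B r s a c \<longleftrightarrow> (\<exists>y. rec_eval h xs = Some y)" .
  have "map (\<lambda>q. int_encode (snd (l ! q))) [0..<length l] = map (\<lambda>(L, b). int_encode b) l"
    for l :: "equation list" by (rule nth_equalityI) (simp_all add: case_prod_beta)
  then have "map (\<lambda>q. int_encode (c q)) [0..<s] = map (\<lambda>(L, b). int_encode b) (P xs @ E)"
    unfolding s c_def .
  also have "\<dots> = map (\<lambda>x. int_encode (int d * int x)) xs @ w"
    by (simp add: P_def w_def xs_def upt_conv_Cons eval_nat_numeral)
  finally have code: "instance_code r s a c = list_encode [r, s, acode,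
      list_encode (map (\<lambda>x. int_encode (int d * int x)) xs @ w)]"
    unfolding instance_code_def acode_def by simp
  have "r > 0" "s > 0" using k by (simp_all add: r_def s_def)
  have "rec_eval (Comp f [rf_code d]) (i # xs) = rec_eval f [instance_code r s a c]" for i
    unfolding code unfolding xs_def by (simp add: rec_eval_code Let_def)
  then have comp: "rec_eval (Comp f [rf_code d]) (i # xs) = Some (if system_solvable m n B r s a c then 1 else 0)" for i
    using f[OF \<open>r > 0\<close> \<open>s > 0\<close>] by simp
  \<comment> \<open>Correctness of \<open>f\<close> makes convergence mean unsolvability, whereas
    the instance was built to make it mean solvability.\<close>
  have "(\<exists>y. rec_eval h xs = Some y) \<longleftrightarrow> \<not> system_solvable m n B r s a c"
    unfolding h_def rec_eval_Mu_eq_Some_iff comp by auto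
  then show False using solvable_iff by blast
qed

end
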